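(* Work in the setting of the context: the network $\mathbf{g}(\mathbf{u},\cdot)$, the forward operator $\mathbf{F}$ and the loss $\mathcal{L}_{\mathbf{y}}$ satisfy the assumptions listed there. Let $\theta(\cdot)$ be a solution trajectory of the gradient flow $\dot\theta(t)=-\nabla_\theta \mathcal{L}_{\mathbf{y}}(\mathbf{F}(\mathbf{g}(\mathbf{u},\theta(t))))$, $\theta(0)=\theta_0$, where the initialization $\theta_0$ is such that $$\sigma_{\min}(\mathcal{J}_{\mathbf{g}}(0))>0\quad\text{and}\quad R'<R,$$ where $R'$ and $R$ obey $$R'=\frac{2}{\sigma_{\mathbf{F}}\,\sigma_{\min}(\mathcal{J}_{\mathbf{g}}(0))}\psi(\mathcal{L}_{\mathbf{y}}(\mathbf{y}(0))),\qquad R=\frac{\sigma_{\min}(\mathcal{J}_{\mathbf{g}}(0))}{2\,\mathrm{Lip}_{\mathbb{B}(\theta_0,R)}(\mathcal{J}_{\mathbf{g}})}.$$ Then the following holds. (i) The loss converges to $0$ at the rate $$\mathcal{L}_{\mathbf{y}}(\mathbf{y}(t))\le \Psi^{-1}(\gamma(t)),$$ with $\Psi$ a primitive of $-(\psi')^2$ and $\gamma(t)=\frac{\sigma_{\mathbf{F}}^2\sigma_{\min}(\mathcal{J}_{\mathbf{g}}(0))^2}{4}t+\Psi(\mathcal{L}_{\mathbf{y}}(\mathbf{y}(0)))$. Moreover, $\theta(t)$ converges to a global minimizer $\theta_\infty$ of $\mathcal{L}_{\mathbf{y}}(\mathbf{F}(\mathbf{g}(\mathbf{u},\cdot)))$,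 at the rate $$\|\theta(t)-\theta_\infty\|\le \frac{2}{\sigma_{\min}(\mathcal{J}_{\mathbf{g}}(0))\,\sigma_{\mathbf{F}}}\,\psi\big(\Psi^{-1}(\gamma(t))\big).$$ (ii) If $\mathrm{Argmin}(\mathcal{L}_{\mathbf{y}})=\{\mathbf{y}\}$, then $\lim_{t\to+\infty}\mathbf{y}(t)=\mathbf{y}$. In addition, if $\mathcal{L}_{\mathbf{y}}$ is convex, then $$\|\mathbf{y}(t)-\overline{\mathbf{y}}\|\le 2\|\varepsilon\|\quad\text{when}\quad t\ge \frac{4\,\Psi(\psi^{-1}(\|\varepsilon\|))}{\sigma_{\mathbf{F}}^2\sigma_{\min}(\mathcal{J}_{\mathbf{g}}(0))^2}-\Psi(\mathcal{L}_{\mathbf{y}}(\mathbf{y}(0))).$$ (iii) Assume that $\mathrm{Argmin}(\mathcal{L}_{\mathbf{y}})=\{\mathbf{y}\}$, that $\mathcal{L}_{\mathbf{y}}$ is convex, and that $\mu_{\mathbf{F}}>0$, where $$\mu_{\mathbf{F}}:=\inf_{\mathbf{x}\in\Sigma'}\frac{\|\mathbf{F}(\mathbf{x})-\mathbf{F}(\overline{\mathbf{x}}_{\Sigma'})\|}{\|\mathbf{x}-\overline{\mathbf{x}}_{\Sigma'}\|},\qquad \Sigma':=\Sigma_{\mathbb{B}(0,R'+\|\theta_0\|)},$$ and $\overline{\mathbf{x}}_{\Sigma'}$ is the projection of $\overline{\mathbf{x}}$ on $\Sigma'$. (Here $\mathrm{Argmin}_{\mathbf{z}\in\Sigma'}\|\mathbf{z}-\overline{\mathbf{x}}\|=\{\overline{\mathbf{x}}_{\Sigma'}\}$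 is supposed to be a singleton; in fact it is only needed that there exists at least one $\overline{\mathbf{x}}_{\Sigma'}$ in this set such that $\mu_{\mathbf{F}}>0$.) Let $L_{\mathbf{F}}:=\max_{\mathbf{x}\in\mathbb{B}(0,2\|\overline{\mathbf{x}}\|)}\|\mathcal{J}_{\mathbf{F}}(\mathbf{x})\|<+\infty$. Then $$\|\mathbf{x}(t)-\overline{\mathbf{x}}\|\le \frac{2\,\psi(\Psi^{-1}(\gamma(t)))}{\mu_{\mathbf{F}}\,\sigma_{\min}(\mathcal{J}_{\mathbf{g}}(0))\,\sigma_{\mathbf{F}}}+\Big(1+\frac{L_{\mathbf{F}}}{\mu_{\mathbf{F}}}\Big)\mathrm{dist}(\overline{\mathbf{x}},\Sigma')+\frac{\|\varepsilon\|}{\mu_{\mathbf{F}}}.$$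
   Context: Notation. $\|\cdot\|$ is the Euclidean norm of vectors and the spectral norm of matrices; for a matrix $M$, $\sigma_{\min}(M)$ is its smallest non-zero singular value; $\mathbb{B}(z,r)$ is the ball of radius $r$ around $z$; $\mathrm{Lip}_{\mathbb{B}(z,r)}(\cdot)$ is the Lipschitz constant on that ball; $\mathrm{dist}(\cdot,S)$ is the distance to the set $S$; $\mathrm{ran}$ denotes the range. Inverse problem. $\overline{\mathbf{x}}\in\mathbb{R}^n$ is the signal, $\mathbf{F}:\mathbb{R}^n\to\mathbb{R}^m$ the forward operator, $\varepsilon\in\mathbb{R}^m$ the noise, $\overline{\mathbf{y}}=\mathbf{F}(\overline{\mathbf{x}})$ and $\mathbf{y}=\mathbf{F}(\overline{\mathbf{x}})+\varepsilon$ the observation; $\mathcal{L}_{\mathbf{y}}:\mathbb{R}^m\to\mathbb{R}_+$ is the loss. Network. $\mathbf{u}\in\mathbb{R}^d$ is a fixed input. $\mathbf{g}(\mathbf{u},\theta)\in\mathbb{R}^n$ is a fully connected network with $L$ layers and parameters $\theta=((W^{(1)},b^{(1)}),\dots,(W^{(L)},b^{(L)}))$, $W^{(l)}\in\mathbb{R}^{N_l\times N_{l-1}}$, $b^{(l)}\in\mathbb{R}^{N_l}$, $N_0=d$, $N_L=n$, identified with a vector in $\mathbb{R}^p$: $\mathbf{g}^{(0)}=\mathbf{u}$, $\mathbf{g}^{(l)}=\phi(W^{(l)}\mathbf{g}^{(l-1)}+b^{(l)})$ for $1\le l\le L-1$ ($\phi$ applied componentwise), $\mathbf{g}=W^{(L)}\mathbf{g}^{(L-1)}+b^{(L)}$.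 $\mathcal{J}_{\mathbf{g}}$ is the Jacobian of $\theta\mapsto\mathbf{g}(\mathbf{u},\theta)$, and $\mathcal{J}_{\mathbf{g}}(t)$ its value at $\theta(t)$. $\mathcal{J}_{\mathbf{F}}(\mathbf{x})$ is the Jacobian of $\mathbf{F}$ at $\mathbf{x}$. $\mathbf{x}(t)=\mathbf{g}(\mathbf{u},\theta(t))$, $\mathbf{y}(t)=\mathbf{F}(\mathbf{x}(t))$. For $\Theta\subset\mathbb{R}^p$, $\Sigma_\Theta=\{\mathbf{g}(\mathbf{u},\theta):\theta\in\Theta\}$. KL inequality. A $C^1$ function $f$ belongs to $\mathrm{KL}_\psi(r_0)$, $r_0>0$, if $\psi\in C^0([0,r_0[)\cap C^1(]0,r_0[)$ is strictly increasing, $\psi(0)=0$, and $\psi'(f(z)-\min f)\|\nabla f(z)\|\ge1$ for all $z$ with $\min f<f(z)<\min f+r_0$. Assumptions. - $\mathcal{L}_{\mathbf{y}}\in C^1(\mathbb{R}^m)$ with gradient Lipschitz continuous on bounded sets; $\mathcal{L}_{\mathbf{y}}\in\mathrm{KL}_\psi(\mathcal{L}_{\mathbf{y}}(\mathbf{y}(0))+\eta)$ for some $\eta>0$; $\min\mathcal{L}_{\mathbf{y}}=0$. - There is $\Theta\subset\mathbb{R}^p$ with large enough diameter (a natural choice is a ball around $\theta_0$ containing the trajectory, or an enlargement of it) such that $\nabla\mathcal{L}_{\mathbf{y}}(\mathbf{v})\in\mathrm{ran}(\mathcal{J}_{\mathbf{F}}(\mathbf{x}))$ for any $\mathbf{v}=\mathbf{F}(\mathbf{x})$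 with $\mathbf{x}\in\Sigma_\Theta$. For this $\Theta$, $\sigma_{\mathbf{F}}:=\inf_{\mathbf{x}\in\Sigma_\Theta,\,z\in\mathrm{ran}(\mathcal{J}_{\mathbf{F}}(\mathbf{x}))}\|\mathcal{J}_{\mathbf{F}}(\mathbf{x})^\top z\|/\|z\|>0$. - $\phi\in C^1(\mathbb{R})$, and for some $B>0$, $\sup_{x}|\phi'(x)|\le B$ and $\phi'$ is $B$-Lipschitz continuous. - $\mathbf{F}\in C^1(\mathbb{R}^n;\mathbb{R}^m)$ with $\mathcal{J}_{\mathbf{F}}$ Lipschitz continuous on bounded sets.
   Formalization: In (ii) the time threshold is corrected to 4(Ψ(ψ⁻¹(‖ε‖))−Ψ(L_y(y(0))))/(σ_F²σ_min²); in (iii) the first term is corrected to ψ(Ψ⁻¹(γ(t)))/μ_F, with the printed term kept only when σ_min·σ_F ≤ 2. Both printed bounds fail in general. *)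

theory Defs
  imports "HOL-Analysis.Analysis"
begin

section \<open>Matrices\<close>

definition spectral_norm :: "real^'n^'m \<Rightarrow> real" where
  "spectral_norm M = onorm ((*v) M)"

definition singular_value :: "real^'n^'m \<Rightarrow> real \<Rightarrow> bool" where
  "singular_value M s \<longleftrightarrow>
     0 \<le> s \<and> (\<exists>v. v \<noteq> 0 \<and> (transpose M ** M) *v v = s\<^sup>2 *\<^sub>R v)"

text \<open>The smallest non-zero singular value. For \<open>M \<noteq> 0\<close> the set is finite and non-empty, so the
  infimum is a minimum.\<close>

definition sigma_min :: "real^'n^'m \<Rightarrow> real" where
  "sigma_min M = Inf {s. singular_value M s \<and> s \<noteq> 0}"

text \<open>The best Lipschitz constant on \<open>S\<close> of a matrix-valued map for the spectral norm
  (the library's \<open>lipschitz_on\<close> would measure matrices in the Frobenius norm).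
  It is \<open>\<infinity>\<close> when the map is not Lipschitz on \<open>S\<close>.\<close>

definition lip_const :: "'a::metric_space set \<Rightarrow> ('a \<Rightarrow> real^'n^'m) \<Rightarrow> ereal" where
  "lip_const S M =
     Inf (ereal ` {C. 0 \<le> C \<and> (\<forall>x\<in>S. \<forall>y\<in>S. spectral_norm (M x - M y) \<le> C * dist x y)})"

definition ecball :: "'a::metric_space \<Rightarrow> ereal \<Rightarrow> 'a set" where
  "ecball z r = {x. ereal (dist z x) \<le> r}"


section \<open>Gradients, minimizers and the Kurdyka--Lojasiewicz inequality\<close>

definition grad :: "('a::euclidean_space \<Rightarrow> real) \<Rightarrow> 'a \<Rightarrow> 'a" where
  "grad f x = (THE D. GDERIV f x :> D)"

definition C1_scalar :: "('a::euclidean_space \<Rightarrow> real) \<Rightarrow> bool" where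
  "C1_scalar f \<longleftrightarrow> (\<forall>x. f differentiable (at x)) \<and> continuous_on UNIV (grad f)"

definition C1_map :: "(real^'n \<Rightarrow> real^'m) \<Rightarrow> bool" where
  "C1_map f \<longleftrightarrow> (\<forall>x. f differentiable (at x)) \<and> continuous_on UNIV (\<lambda>x. jacobian f (at x))"

definition Argmin :: "('a \<Rightarrow> real) \<Rightarrow> 'a set" where
  "Argmin f = {x. is_arg_min f (\<lambda>_. True) x}"

text \<open>\<open>Inf (range f)\<close> stands for \<open>min f\<close>; only the values of \<open>\<psi>\<close> on \<open>[0, r0[\<close> matter.\<close>

definition KL :: "(real \<Rightarrow> real) \<Rightarrow> real \<Rightarrow> ('a::euclidean_space \<Rightarrow> real) \<Rightarrow> bool" where
  "KL \<psi> r0 f \<longleftrightarrow>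
     C1_scalar f \<and> 0 < r0 \<and>
     continuous_on {0..<r0} \<psi> \<and>
     (\<forall>s\<in>{0<..<r0}. \<psi> differentiable (at s)) \<and> continuous_on {0<..<r0} (deriv \<psi>) \<and>
     strict_mono_on {0..<r0} \<psi> \<and> \<psi> 0 = 0 \<and>
     (\<forall>z. Inf (range f) < f z \<and> f z < Inf (range f) + r0 \<longrightarrow>
        deriv \<psi> (f z - Inf (range f)) * norm (grad f z) \<ge> 1)"

definition primitive_on :: "real set \<Rightarrow> (real \<Rightarrow> real) \<Rightarrow> (real \<Rightarrow> real) \<Rightarrow> bool" where
  "primitive_on S h H \<longleftrightarrow> (\<forall>s\<in>S. (H has_real_derivative h s) (at s))"

text \<open>A primitive \<open>\<Psi>\<close> of \<open>- (\<psi>')\<^sup>2\<close> on \<open>]0, r0[\<close> is strictly decreasing and, \<open>\<psi>'\<close> being in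
  general unbounded near \<open>0\<close>, typically blows up at \<open>0\<close>. It is extended to \<open>0\<close> by its limit in
  \<open>]-\<infinity>, \<infinity>]\<close>.\<close>

definition ext_prim :: "(real \<Rightarrow> real) \<Rightarrow> real \<Rightarrow> ereal" where
  "ext_prim \<Psi> s = (if s = 0 then Lim (at_right 0) (\<lambda>r. ereal (\<Psi> r)) else ereal (\<Psi> s))"

text \<open>The inverse of the extended \<open>\<Psi>\<close> on \<open>[0, r0[\<close>, continued by \<open>0\<close> above \<open>\<Psi>(0)\<close>
  (which can only be needed when \<open>\<Psi>(0)\<close> is finite).\<close>

definition prim_inv :: "real \<Rightarrow> (real \<Rightarrow> real) \<Rightarrow> ereal \<Rightarrow> real" where
  "prim_inv r0 \<Psi> \<tau> =
     (if ext_prim \<Psi> 0 \<le> \<tau> then 0 else inv_into {0..<r0} (ext_prim \<Psi>) \<tau>)"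


section \<open>Fully connected networks\<close>

text \<open>\<open>Weight l i j\<close> and \<open>Bias l i\<close> name the entries \<open>W\<^sup>(\<^sup>l\<^sup>)\<^sub>i\<^sub>j\<close> and \<open>b\<^sup>(\<^sup>l\<^sup>)\<^sub>i\<close>, with
  layers numbered from 1 and rows and columns from 0. The identification of the parameters with a
  vector of \<open>real^'p\<close> is a bijection \<open>e\<close> from these names onto the coordinates \<open>'p\<close>; in
  particular \<open>CARD('p)\<close> is the number of parameters.\<close>

datatype param = Weight nat nat nat | Bias nat nat

definition params :: "(nat \<Rightarrow> nat) \<Rightarrow> nat \<Rightarrow> param set" where
  "params N L =
     {Weight l i j | l i j. 1 \<le> l \<and> l \<le> L \<and> i < N l \<and> j < N (l - 1)} \<union>
     {Bias l i | l i. 1 \<le> l \<and> l \<le> L \<and> i < N l}"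

definition layer_affine ::
  "(nat \<Rightarrow> nat) \<Rightarrow> (param \<Rightarrow> 'p::finite) \<Rightarrow> real^'p \<Rightarrow> nat \<Rightarrow> (nat \<Rightarrow> real) \<Rightarrow> nat \<Rightarrow> real" where
  "layer_affine N e \<theta> l h i =
     (\<Sum>j<N (l - 1). \<theta> $ e (Weight l i j) * h j) + \<theta> $ e (Bias l i)"

primrec hidden ::
  "(real \<Rightarrow> real) \<Rightarrow> (nat \<Rightarrow> nat) \<Rightarrow> (param \<Rightarrow> 'p::finite) \<Rightarrow> (nat \<Rightarrow> real) \<Rightarrow> real^'p \<Rightarrow>
   nat \<Rightarrow> nat \<Rightarrow> real" where
  "hidden \<phi> N e u \<theta> 0 = u"
| "hidden \<phi> N e u \<theta> (Suc l) = (\<lambda>i. \<phi> (layer_affine N e \<theta> (Suc l) (hidden \<phi> N e u \<theta> l) i))"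

text \<open>The coordinates of the input in \<open>real^'d\<close> and of the output in \<open>real^'n\<close> are numbered by the
  library's enumerations \<open>from_nat_into UNIV\<close> and \<open>to_nat_on UNIV\<close> of finite types.\<close>

definition network ::
  "(real \<Rightarrow> real) \<Rightarrow> (nat \<Rightarrow> nat) \<Rightarrow> nat \<Rightarrow> (param \<Rightarrow> 'p::finite) \<Rightarrow> real^'d::finite \<Rightarrow> real^'p \<Rightarrow>
   real^'n::finite" where
  "network \<phi> N L e u \<theta> =
     (\<chi> k. layer_affine N e \<theta> L
             (hidden \<phi> N e (\<lambda>j. u $ from_nat_into UNIV j) \<theta> (L - 1)) (to_nat_on UNIV k))"


section \<open>Constants of the forward operator\<close>

text \<open>\<open>sigma_F F S\<close> and \<open>mu_F F S p\<close> are infima of quotients, over the points where the denominator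
  does not vanish.\<close>

definition sigma_F :: "(real^'n \<Rightarrow> real^'m) \<Rightarrow> (real^'n) set \<Rightarrow> real" where
  "sigma_F F S = Inf {norm (transpose (jacobian F (at x)) *v z) / norm z | x z.
                        x \<in> S \<and> z \<in> range ((*v) (jacobian F (at x))) \<and> z \<noteq> 0}"

definition mu_F :: "(real^'n \<Rightarrow> real^'m) \<Rightarrow> (real^'n) set \<Rightarrow> real^'n \<Rightarrow> real" where
  "mu_F F S p = Inf {norm (F x - F p) / norm (x - p) | x. x \<in> S \<and> x \<noteq> p}"

definition L_F :: "(real^'n \<Rightarrow> real^'m) \<Rightarrow> real^'n \<Rightarrow> real" where
  "L_F F xbar = (SUP x\<in>cball 0 (2 * norm xbar). spectral_norm (jacobian F (at x)))"

end

theory Submission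
  imports Defs
begin

text \<open>
  Along the flow, \<open>\<psi>(loss)\<close> is a Lyapunov function that controls length: with
  \<open>k = \<sigma> \<sigma>\<^sub>F / 2\<close> the KL inequality gives \<open>k \<parallel>\<theta>'\<parallel> \<le> - d/dt \<psi>(loss)\<close>, as long as
  \<open>\<parallel>J\<^sub>g(\<theta>)\<^sup>T z\<parallel> \<ge> \<sigma>/2 \<parallel>z\<parallel>\<close>. At \<open>\<theta>\<^sub>0\<close> this holds with \<open>\<sigma>\<close> because the output biases make
  \<open>J\<^sub>g\<close> surjective, so that no singular value of \<open>J\<^sub>g\<^sup>T\<close> vanishes, and it survives on the ball of
  radius \<open>R\<close> by the choice of \<open>R\<close>. The trajectory has length at most
  \<open>R' = \<psi>(loss(0)) / k < R\<close>, hence never leaves this ball and converges, while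
  \<open>d/dt \<Psi>(loss) \<ge> k\<^sup>2\<close> gives the rate. The bounds on the observation and on the signal follow
  from the error bound \<open>\<parallel>v - y\<parallel> \<le> \<psi>(loss v)\<close>, itself a consequence of the KL inequality.
\<close>

section \<open>Singular values and spectral norms\<close>

text \<open>As a simp rule this would rewrite \<open>transpose M *v z\<close> to
  \<open>z v* M\<close>; the bounds below are all stated in the former shape.\<close>

declare transpose_matrix_vector [simp del]

lemma inner_matrix_transpose:
  fixes M :: "real^'n^'m"
  shows "(transpose M *v z) \<bullet> x = z \<bullet> (M *v x)"
  by (simp add: dot_lmul_matrix flip: vector_transpose_matrix)

lemma norm_mult_le_spectral_norm:
  fixes M :: "real^'n^'m"
  shows "norm (M *v x) \<le> spectral_norm M * norm x"
  unfolding spectral_norm_def by (rule onorm) simp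

text \<open>The square of the left side is the inner product of \<open>z\<close> with
  \<open>M *v (transpose M *v z)\<close>; after Cauchy-Schwarz one factor cancels.\<close>

lemma norm_transpose_mult_le_spectral_norm:
  fixes M :: "real^'n^'m"
  shows "norm (transpose M *v z) \<le> spectral_norm M * norm z"
proof (cases "transpose M *v z = 0")
  case True
  have "0 \<le> spectral_norm M"
    unfolding spectral_norm_def by (rule onorm_pos_le) simp
  with True show ?thesis by simp
next
  case False
  have "norm (transpose M *v z) * norm (transpose M *v z) = z \<bullet> (M *v (transpose M *v z))"
    unfolding power2_eq_square[symmetric] power2_norm_eq_inner inner_matrix_transpose by (rule refl)
  also have "\<dots> \<le> norm z * norm (M *v (transpose M *v z))"
    by (rule norm_cauchy_schwarz)
  also have "\<dots> \<le> norm z * (spectral_norm M * norm (transpose M *v z))"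
    by (intro mult_left_mono norm_mult_le_spectral_norm) simp
  finally show ?thesis
    using False mult_right_le_imp_le[of "norm (transpose M *v z)" "norm (transpose M *v z)"]
    by (simp add: ac_simps)
qed

text \<open>Perturbation estimate: it carries the lower bound on the transposed network Jacobian
  from \<theta>0 to nearby parameters.\<close>

lemma norm_transpose_mult_ge:
  fixes A B :: "real^'n^'m"
  shows "norm (transpose B *v z) - spectral_norm (A - B) * norm z \<le> norm (transpose A *v z)"
proof -
  have "transpose A *v z = transpose B *v z + transpose (A - B) *v z"
    by (simp add: transpose_matrix_vector vector_matrix_mult_def vec_eq_iff algebra_simps
        flip: sum.distrib)
  then show ?thesis
    using norm_transpose_mult_le_spectral_norm[of "A - B" z]
      norm_triangle_ineq2[of "transpose B *v z" "- (transpose (A - B) *v z)"] by simp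
qed

text \<open>First-order optimality in algebraic form: whatever the sign of \<open>b\<close>, the
  linear term dominates for small \<open>t\<close>.\<close>

lemma nonneg_quadratic_imp_linear_zero:
  fixes a b :: real
  assumes "\<And>t. 0 \<le> 2 * t * a + t\<^sup>2 * b"
  shows "a = 0"
proof (rule ccontr)
  assume "a \<noteq> 0"
  \<comment> \<open>Large enough that \<open>t = - a / c\<close> makes the expression
    negative.\<close>
  define c where "c = \<bar>b\<bar> + 1"
  have "c > 0" "b < 2 * c" by (auto simp: c_def)
  have "2 * (- a / c) * a + (- a / c)\<^sup>2 * b = (a\<^sup>2 / c\<^sup>2) * (b - 2 * c)"
    using \<open>c > 0\<close> by (simp add: field_simps power2_eq_square)
  also have "\<dots> < 0"
    using \<open>a \<noteq> 0\<close> \<open>c > 0\<close> \<open>b < 2 * c\<close> by (intro mult_pos_neg) auto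
  finally show False using assms[of "- a / c"] by simp
qed

text \<open>A minimizer of the Rayleigh quotient of \<open>M M\<^sup>T\<close> is an eigenvector \<open>z\<close>, and \<open>M\<^sup>T z\<close> is then
  an eigenvector of \<open>M\<^sup>T M\<close> for the same eigenvalue, which injectivity makes non-zero.\<close>

lemma sigma_min_mult_norm_le:
  fixes M :: "real^'n^'m"
  assumes inj: "\<And>z. transpose M *v z = 0 \<Longrightarrow> z = 0"
  shows "sigma_min M * norm z \<le> norm (transpose M *v z)"
proof -
  let ?T = "\<lambda>z. transpose M *v z"
  have cont: "continuous_on (sphere 0 1) (\<lambda>z. norm (?T z))"
    by (intro continuous_on_norm linear_continuous_on matrix_vector_mul_bounded_linear)
  have "axis undefined 1 \<in> sphere (0::real^'m) 1"
    by (simp add: norm_axis_1)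
  then obtain z0 where z0: "norm z0 = 1" and min: "\<And>z. norm z = 1 \<Longrightarrow> norm (?T z0) \<le> norm (?T z)"
    using continuous_attains_inf[OF compact_sphere _ cont] by (metis empty_iff mem_sphere_0)
  define s where "s = norm (?T z0)"
  have s_le: "s * norm z \<le> norm (?T z)" for z
  proof (cases "z = 0")
    case False
    then have "s \<le> norm (?T ((1 / norm z) *\<^sub>R z))"
      unfolding s_def by (intro min) simp
    with False show ?thesis
      by (simp add: matrix_vector_mult_scaleR field_simps)
  qed simp
  \<comment> \<open>The residual of the eigenvalue equation. Moving \<open>z0\<close> in this
    direction has first variation \<open>w \<bullet> w\<close> (up to a factor 2), so minimality
    forces \<open>w = 0\<close>.\<close>
  define w where "w = M *v ?T z0 - s\<^sup>2 *\<^sub>R z0"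
  have "0 \<le> 2 * t * (w \<bullet> w) + t\<^sup>2 * ((norm (?T w))\<^sup>2 - s\<^sup>2 * (norm w)\<^sup>2)" for t
  proof -
    have "(s * norm (z0 + t *\<^sub>R w))\<^sup>2 \<le> (norm (?T (z0 + t *\<^sub>R w)))\<^sup>2"
      by (intro power_mono s_le) (simp add: s_def)
    also have "norm (?T (z0 + t *\<^sub>R w)) = norm (?T z0 + t *\<^sub>R ?T w)"
      by (simp add: matrix_vector_mult_scaleR matrix_vector_right_distrib)
    also have "(norm (?T z0 + t *\<^sub>R ?T w))\<^sup>2 = s\<^sup>2 + 2 * t * (w \<bullet> (M *v ?T z0)) + t\<^sup>2 * (norm (?T w))\<^sup>2"
      unfolding power2_norm_eq_inner s_def
      by (simp add: inner_add inner_commute[of "?T z0" "?T w"] inner_matrix_transpose[of M w "?T z0"]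
          power2_eq_square algebra_simps)
    finally have "s\<^sup>2 * (norm (z0 + t *\<^sub>R w))\<^sup>2 \<le> \<dots>"
      by (simp add: power_mult_distrib)
    moreover have "(norm (z0 + t *\<^sub>R w))\<^sup>2 = 1 + 2 * t * (w \<bullet> z0) + t\<^sup>2 * (norm w)\<^sup>2"
      using z0 unfolding power2_norm_eq_inner norm_eq_1
      by (simp add: inner_add inner_commute[of z0 w] power2_eq_square algebra_simps)
    moreover have "w \<bullet> (M *v ?T z0) = w \<bullet> w + s\<^sup>2 * (w \<bullet> z0)"
      by (subst (3) w_def) (simp add: inner_diff_right)
    ultimately show ?thesis
      by (simp add: algebra_simps)
  qed
  then have "w \<bullet> w = 0"
    by (rule nonneg_quadratic_imp_linear_zero)
  then have eig: "M *v ?T z0 = s\<^sup>2 *\<^sub>R z0"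
    by (simp add: w_def)
  have "?T z0 \<noteq> 0"
    using inj[of z0] z0 by auto
  moreover have "(transpose M ** M) *v ?T z0 = s\<^sup>2 *\<^sub>R ?T z0"
    by (simp add: eig matrix_vector_mult_scaleR flip: matrix_vector_mul_assoc)
  ultimately have "singular_value M s" "s \<noteq> 0"
    unfolding singular_value_def by (auto simp: s_def)
  then have "sigma_min M \<le> s"
    unfolding sigma_min_def by (intro cInf_lower bdd_belowI[of _ 0]) (auto simp: singular_value_def)
  then show ?thesis
    using s_le[of z] mult_right_mono[of "sigma_min M" s "norm z"] by simp
qed

text \<open>The infimum is itself an admissible constant: for distinct points, the quotient by the
  distance lies below every admissible one.\<close>

lemma spectral_norm_diff_le_lip_const:
  assumes "lip_const S M = ereal C" "x \<in> S" "y \<in> S"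
  shows "spectral_norm (M x - M y) \<le> C * dist x y"
proof (cases "x = y")
  case True
  then have "(*v) (M x - M y) = (\<lambda>_. 0)" by auto
  then show ?thesis using True by (simp add: spectral_norm_def onorm_zero)
next
  case False
  then have d: "dist x y > 0" by simp
  have "spectral_norm (M x - M y) / dist x y \<le> C"
    unfolding ereal_less_eq(3)[symmetric] assms(1)[symmetric] lip_const_def
    using assms(2,3) d by (auto intro!: Inf_greatest simp: field_simps)
  then show ?thesis using d by (simp add: field_simps)
qed

lemma lip_const_nonneg: "0 \<le> lip_const S M"
  unfolding lip_const_def by (intro Inf_greatest) auto

text \<open>Without a Lipschitz bound on the ball the equation for \<open>R\<close> would force \<open>R = 0\<close>; in the
  Lipschitz case \<open>C * R = \<sigma> / 2\<close>, or \<open>C = 0\<close> and \<open>R = \<infinity>\<close>.\<close>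

lemma spectral_norm_diff_le_of_radius_eq:
  assumes R: "R = ereal \<sigma> / (2 * lip_const (ecball z R) M)" and "0 < \<sigma>" "0 < R"
    and x: "x \<in> ecball z R"
  shows "spectral_norm (M x - M z) \<le> \<sigma> / 2"
proof -
  have "lip_const (ecball z R) M \<noteq> \<infinity>"
    using R \<open>0 < R\<close> by auto
  then obtain C where C: "lip_const (ecball z R) M = ereal C"
    using lip_const_nonneg[of "ecball z R" M]
    by (cases "lip_const (ecball z R) M") auto
  then have "0 \<le> C"
    using lip_const_nonneg[of "ecball z R" M] by simp
  have z: "z \<in> ecball z R"
    using \<open>0 < R\<close> by (simp add: ecball_def zero_ereal_def[symmetric] order.strict_implies_order)
  have "C * dist x z \<le> \<sigma> / 2"
  proof (cases "C = 0")
    case True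
    then show ?thesis using \<open>0 < \<sigma>\<close> by simp
  next
    case False
    then have "R = ereal (\<sigma> / (2 * C))"
      using R \<open>0 \<le> C\<close> unfolding C by (simp add: numeral_eq_ereal)
    then have "dist x z \<le> \<sigma> / (2 * C)"
      using x by (simp add: ecball_def dist_commute)
    then show ?thesis
      using False \<open>0 \<le> C\<close> by (simp add: field_simps)
  qed
  then show ?thesis
    using spectral_norm_diff_le_lip_const[OF C x z] by simp
qed

section \<open>Gradients\<close>

lemma grad_eqI:
  assumes "GDERIV f x :> D"
  shows "grad f x = D"
  unfolding grad_def
proof (rule the_equality)
  show "GDERIV f x :> D" by fact
  fix E assume "GDERIV f x :> E"
  then have "(\<lambda>h. h \<bullet> E) = (\<lambda>h. h \<bullet> D)"
    using assms unfolding gderiv_def by (rule has_derivative_unique)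
  then have "(E - D) \<bullet> E = (E - D) \<bullet> D" by metis
  then have "(E - D) \<bullet> (E - D) = 0" by (simp add: inner_diff_right)
  then show "E = D" by simp
qed

lemma differentiable_imp_GDERIV:
  fixes f :: "'a::euclidean_space \<Rightarrow> real"
  assumes "f differentiable (at x)"
  shows "GDERIV f x :> grad f x"
proof -
  obtain f' where f': "(f has_derivative f') (at x)"
    using assms by (auto simp: differentiable_def)
  have lin: "linear f'" using f' by (rule has_derivative_linear)
  \<comment> \<open>Riesz representation of the linear functional \<open>f'\<close>.\<close>
  define D where "D = adjoint f' 1"
  have "f' = (\<lambda>h. h \<bullet> D)"
    using adjoint_works[OF lin, of _ 1] by (auto simp: D_def inner_commute)
  then have D: "GDERIV f x :> D"
    using f' by (simp add: gderiv_def)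
  then show ?thesis by (simp add: grad_eqI)
qed

lemma GDERIV_compose_jacobian:
  fixes G :: "real^'n \<Rightarrow> real^'m"
  assumes "f differentiable (at (G x))" "G differentiable (at x)"
  shows "GDERIV (\<lambda>x. f (G x)) x :> transpose (jacobian G (at x)) *v grad f (G x)"
proof -
  have "((\<lambda>x. f (G x)) has_derivative (\<lambda>h. (jacobian G (at x) *v h) \<bullet> grad f (G x))) (at x)"
    using differentiable_imp_GDERIV[OF assms(1)] assms(2)
    unfolding gderiv_def jacobian_works by (rule has_derivative_compose[rotated])
  then show ?thesis
    using inner_matrix_transpose[of "jacobian G (at x)" "grad f (G x)"]
    by (simp add: gderiv_def inner_commute)
qed

lemma DERIV_compose_curve:
  fixes f :: "'a::euclidean_space \<Rightarrow> real"
  assumes "GDERIV f (p t) :> D" "(p has_vector_derivative v) (at t)"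
  shows "((\<lambda>t. f (p t)) has_real_derivative v \<bullet> D) (at t)"
  using has_derivative_compose[OF assms(2)[unfolded has_vector_derivative_def] assms(1)[unfolded gderiv_def]]
  by (simp add: has_field_derivative_def mult_commute_abs)

section \<open>The Jacobian of the network\<close>

lemma differentiable_vec_nth: "(\<lambda>x::real^'n. x $ i) differentiable (at x0)"
  by (rule bounded_linear_imp_differentiable) (rule bounded_linear_vec_nth)

lemma differentiable_hidden:
  assumes "\<And>s. \<phi> differentiable (at s)"
  shows "(\<lambda>\<theta>. hidden \<phi> N e u \<theta> l i) differentiable (at \<theta>0)"
proof (induction l arbitrary: i)
  case (Suc l)
  have "(\<lambda>\<theta>. layer_affine N e \<theta> (Suc l) (hidden \<phi> N e u \<theta> l) i) differentiable (at \<theta>0)"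
    unfolding layer_affine_def
    by (intro differentiable_add differentiable_sum differentiable_mult Suc.IH differentiable_vec_nth
        ballI finite_lessThan)
  then show ?case
    using differentiable_compose[OF assms] by simp
qed simp

lemma differentiable_vec_lambda:
  fixes f :: "'a::real_normed_vector \<Rightarrow> 'n::finite \<Rightarrow> real"
  assumes "\<And>k. (\<lambda>x. f x k) differentiable (at x0)"
  shows "(\<lambda>x. \<chi> k. f x k) differentiable (at x0)"
  unfolding differentiable_componentwise_within[of "\<lambda>x. \<chi> k. f x k"]
  using assms by (auto simp: Basis_vec_def inner_axis)

lemma differentiable_network:
  assumes "\<And>s. \<phi> differentiable (at s)"
  shows "network \<phi> N L e u differentiable (at \<theta>0)"
proof -
  have "(\<lambda>\<theta>. network \<phi> N L e u \<theta>) differentiable (at \<theta>0)"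
    unfolding network_def layer_affine_def
    by (rule differentiable_vec_lambda)
      (intro differentiable_add differentiable_sum differentiable_mult differentiable_hidden
        assms differentiable_vec_nth ballI finite_lessThan)
  then show ?thesis by simp
qed

text \<open>Hidden layers see only the parameters of their own and earlier layers; hence a change of
  an output bias leaves them fixed. The bound on \<open>i\<close> keeps the names inside
  \<open>params\<close>.\<close>

lemma hidden_cong:
  assumes "\<And>q. q \<in> params N l \<Longrightarrow> \<theta> $ e q = \<theta>' $ e q" and "i < N l"
  shows "hidden \<phi> N e u \<theta> l i = hidden \<phi> N e u \<theta>' l i"
  using assms
proof (induction l arbitrary: i)
  case (Suc l)
  have "hidden \<phi> N e u \<theta> l j = hidden \<phi> N e u \<theta>' l j" if "j < N l" for j
    using Suc.prems(1) that by (intro Suc.IH) (force simp: params_def)+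
  moreover have "\<theta> $ e (Weight (Suc l) i j) = \<theta>' $ e (Weight (Suc l) i j)" if "j < N l" for j
    using Suc.prems that by (intro Suc.prems(1)) (auto simp: params_def)
  moreover have "\<theta> $ e (Bias (Suc l) i) = \<theta>' $ e (Bias (Suc l) i)"
    using Suc.prems by (intro Suc.prems(1)) (auto simp: params_def)
  ultimately show ?case
    by (simp add: layer_affine_def)
qed simp

text \<open>No activation follows the last layer, so an output bias enters additively and acts on
  its own coordinate alone.\<close>

lemma network_add_bias:
  fixes e :: "param \<Rightarrow> 'p::finite" and u :: "real^'d" and k :: "'n::finite"
  assumes "1 \<le> L" and "N L = CARD('n)" and inj: "inj_on e (params N L)"
  shows "network \<phi> N L e u (\<theta> + s *\<^sub>R axis (e (Bias L (to_nat_on UNIV k))) 1) =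
    network \<phi> N L e u \<theta> + s *\<^sub>R axis k 1"
proof (rule vec_eq_iff[THEN iffD2], rule allI)
  fix k' :: 'n
  define nr where "nr = to_nat_on (UNIV :: 'n set)"
  define \<theta>' where "\<theta>' = \<theta> + s *\<^sub>R axis (e (Bias L (nr k))) 1"
  have nr_less: "nr k < N L" for k
    using to_nat_on_finite[of "UNIV :: 'n set"] assms(2)
    unfolding nr_def bij_betw_def by (simp add: set_eq_iff) blast
  have inj_nr: "nr k = nr k' \<longleftrightarrow> k = k'" for k k'
    unfolding nr_def by (simp add: uncountable_infinite)
  have bias: "Bias L (nr k) \<in> params N L" for k
    using nr_less[of k] \<open>1 \<le> L\<close> by (auto simp: params_def)
  \<comment> \<open>Injectivity of \<open>e\<close> ensures that the perturbed coordinate stores no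
    other parameter.\<close>
  have coord: "\<theta>' $ e q = \<theta> $ e q + (if q = Bias L (nr k) then s else 0)" if "q \<in> params N L" for q
    using inj_onD[OF inj _ that bias] by (auto simp: \<theta>'_def axis_def)
  obtain l where L: "L = Suc l"
    using \<open>1 \<le> L\<close> by (cases L) auto
  have "hidden \<phi> N e v \<theta>' l j = hidden \<phi> N e v \<theta> l j" if "j < N l" for j v
  proof (rule hidden_cong)
    show "j < N l" by fact
    fix q assume "q \<in> params N l"
    then show "\<theta>' $ e q = \<theta> $ e q"
      using coord[of q] unfolding L by (auto simp: params_def)
  qed
  moreover have "\<theta>' $ e (Weight L (nr k') j) = \<theta> $ e (Weight L (nr k') j)" if "j < N l" for j
    using coord[of "Weight L (nr k') j"] that nr_less[of k'] unfolding L by (auto simp: params_def)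
  moreover have "\<theta>' $ e (Bias L (nr k')) = \<theta> $ e (Bias L (nr k')) + (if k' = k then s else 0)"
    using coord[OF bias, of k'] by (simp add: inj_nr)
  ultimately have "network \<phi> N L e u \<theta>' $ k' = network \<phi> N L e u \<theta> $ k' + (if k' = k then s else 0)"
    unfolding network_def L by (simp add: layer_affine_def flip: nr_def)
  then show "network \<phi> N L e u (\<theta> + s *\<^sub>R axis (e (Bias L (to_nat_on UNIV k))) 1) $ k' =
      (network \<phi> N L e u \<theta> + s *\<^sub>R axis k 1) $ k'"
    unfolding \<theta>'_def nr_def by (simp add: axis_def)
qed

text \<open>The output biases already make the Jacobian surjective.\<close>

lemma transpose_jacobian_network_eq_0:
  fixes e :: "param \<Rightarrow> 'p::finite" and u :: "real^'d" and z :: "real^'n::finite"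
    and g :: "real^'p \<Rightarrow> real^'n"
  assumes g_def: "g = network \<phi> N L e u" and "\<And>s. \<phi> differentiable (at s)" "1 \<le> L" "N L = CARD('n)" "inj_on e (params N L)"
    and z: "transpose (jacobian g (at \<theta>)) *v z = 0"
  shows "z = 0"
proof (rule vec_eq_iff[THEN iffD2], rule allI)
  fix k :: 'n
  \<comment> \<open>The direction of the k-th output bias. Computing the derivative of
    \<open>g\<close> along it in two ways shows that the Jacobian maps it to
    \<open>axis k 1\<close>; pairing with \<open>z\<close> then reads off
    \<open>z $ k\<close>.\<close>
  define b where "b = (axis (e (Bias L (to_nat_on UNIV k))) 1 :: real^'p)"
  have "(g has_derivative (*v) (jacobian g (at \<theta>))) (at (\<theta> + (0::real) *\<^sub>R b))"
    using differentiable_network[OF assms(2), of N L e u \<theta>] unfolding g_def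
    by (simp add: jacobian_works)
  moreover have "((\<lambda>s::real. \<theta> + s *\<^sub>R b) has_derivative (\<lambda>s. s *\<^sub>R b)) (at 0)"
    by (auto intro!: derivative_eq_intros)
  ultimately have "((\<lambda>s::real. g (\<theta> + s *\<^sub>R b)) has_derivative (\<lambda>s. jacobian g (at \<theta>) *v (s *\<^sub>R b))) (at 0)"
    using has_derivative_compose by fast
  moreover have "((\<lambda>s::real. g (\<theta> + s *\<^sub>R b)) has_derivative (\<lambda>s. s *\<^sub>R axis k 1)) (at 0)"
    unfolding g_def b_def network_add_bias[OF assms(3-5)]
    by (auto intro!: derivative_eq_intros)
  ultimately have "(\<lambda>s. jacobian g (at \<theta>) *v (s *\<^sub>R b)) = (\<lambda>s::real. s *\<^sub>R axis k 1)"
    by (rule has_derivative_unique)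
  then have "jacobian g (at \<theta>) *v b = axis k 1"
    by (metis scaleR_one)
  then have "z $ k = z \<bullet> (jacobian g (at \<theta>) *v b)"
    by (simp add: inner_axis)
  then show "z $ k = (0 :: real^'n) $ k"
    using z by (simp flip: inner_matrix_transpose)
qed

text \<open>Puts the origin into \<Sigma>', which bounds the norm of the projection of
  \<open>xbar\<close>.\<close>

lemma network_0:
  fixes u :: "real^'d"
  shows "network \<phi> N L e u 0 = (0 :: real^'n::finite)"
  by (simp add: network_def layer_affine_def vec_eq_iff)

section \<open>Desingularizing functions and the error bound\<close>

text \<open>The same \<psi> serves the loss over observations (error bound) and the composite loss
  over parameters (flow), so its properties are collected apart from either function.\<close>

locale desingularizer =
  fixes \<psi> \<Psi> :: "real \<Rightarrow> real" and r0 :: real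
  assumes r0_pos: "0 < r0"
    and continuous: "continuous_on {0..<r0} \<psi>"
    and differentiable: "\<And>s. s \<in> {0<..<r0} \<Longrightarrow> \<psi> differentiable (at s)"
    and strict_mono: "strict_mono_on {0..<r0} \<psi>"
    and zero: "\<psi> 0 = 0"
    and primitive: "primitive_on {0<..<r0} (\<lambda>s. - (deriv \<psi> s)\<^sup>2) \<Psi>"
begin

lemma mono: "0 \<le> a \<Longrightarrow> a \<le> b \<Longrightarrow> b < r0 \<Longrightarrow> \<psi> a \<le> \<psi> b"
  using strict_mono_onD[OF strict_mono, of a b] by (cases "a = b") auto

lemma nonneg: "0 \<le> s \<Longrightarrow> s < r0 \<Longrightarrow> 0 \<le> \<psi> s"
  using mono[of 0 s] zero by simp

lemma DERIV_psi: "0 < s \<Longrightarrow> s < r0 \<Longrightarrow> (\<psi> has_real_derivative deriv \<psi> s) (at s)"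
  using differentiable by (simp add: DERIV_deriv_iff_real_differentiable)

lemma DERIV_prim: "0 < s \<Longrightarrow> s < r0 \<Longrightarrow> (\<Psi> has_real_derivative - (deriv \<psi> s)\<^sup>2) (at s)"
  using primitive by (simp add: primitive_on_def)

lemma prim_antimono:
  assumes "0 < a" "a \<le> b" "b < r0"
  shows "\<Psi> b \<le> \<Psi> a"
  using assms(2)
proof (rule DERIV_nonpos_imp_nonincreasing)
  fix x assume "a \<le> x" "x \<le> b"
  then show "\<exists>y. (\<Psi> has_real_derivative y) (at x) \<and> y \<le> 0"
    using assms DERIV_prim[of x] by (intro exI[of _ "- (deriv \<psi> x)\<^sup>2"]) auto
qed

text \<open>The derivative of a strictly increasing \<psi> may vanish at some points. The mean value
  theorem supplies one point \<open>s\<close> between \<open>a\<close> and \<open>b\<close> where it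
  does not; the strict drop of \<Psi> just after \<open>s\<close> suffices.\<close>

lemma prim_strict_antimono:
  assumes "0 < a" "a < b" "b < r0"
  shows "\<Psi> b < \<Psi> a"
proof -
  have "\<exists>s>a. s < b \<and> \<psi> b - \<psi> a = (b - a) * deriv \<psi> s"
    using assms by (intro MVT2 DERIV_psi) auto
  then obtain s where s: "a < s" "s < b" "\<psi> b - \<psi> a = (b - a) * deriv \<psi> s" by auto
  have "\<psi> a < \<psi> b"
    using strict_mono_onD[OF strict_mono, of a b] assms by auto
  then have "deriv \<psi> s \<noteq> 0" using s by auto
  then have "- (deriv \<psi> s)\<^sup>2 < 0" by simp
  moreover have "(\<Psi> has_real_derivative - (deriv \<psi> s)\<^sup>2) (at s)"
    using s assms by (intro DERIV_prim) auto
  ultimately obtain d where d: "d > 0" "\<And>h. 0 < h \<Longrightarrow> h < d \<Longrightarrow> \<Psi> (s + h) < \<Psi> s"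
    using DERIV_neg_dec_right by blast
  define h where "h = min (d / 2) ((b - s) / 2)"
  have h: "0 < h" "h < d" "s + h < b"
    using d(1) s by (auto simp: h_def min_def field_simps)
  have "\<Psi> b \<le> \<Psi> (s + h)" "\<Psi> s \<le> \<Psi> a"
    using assms s h by (auto intro!: prim_antimono)
  with d(2)[OF h(1,2)] show ?thesis by simp
qed

text \<open>Monotonicity of \<Psi> makes the limit at 0 exist in the extended reals, so
  \<open>Lim\<close> denotes a genuine limit, possibly infinite.\<close>

lemma ext_prim_0: "ext_prim \<Psi> 0 = (SUP r\<in>{0<..<r0}. ereal (\<Psi> r))"
proof -
  have small: "\<forall>\<^sub>F r in at_right 0. 0 < r \<and> r < b" if "0 < b" for b :: real
    using that eventually_at_right_real[of 0 b] by (auto elim: eventually_mono)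
  have "((\<lambda>r. ereal (\<Psi> r)) \<longlongrightarrow> (SUP r\<in>{0<..<r0}. ereal (\<Psi> r))) (at_right 0)"
  proof (rule increasing_tendsto)
    show "\<forall>\<^sub>F r in at_right 0. ereal (\<Psi> r) \<le> (SUP r\<in>{0<..<r0}. ereal (\<Psi> r))"
      using small[OF r0_pos] by eventually_elim (auto intro: SUP_upper)
  next
    fix x assume "x < (SUP r\<in>{0<..<r0}. ereal (\<Psi> r))"
    then obtain r where r: "0 < r" "r < r0" "x < ereal (\<Psi> r)"
      by (auto simp: less_SUP_iff)
    show "\<forall>\<^sub>F r in at_right 0. x < ereal (\<Psi> r)"
      using small[OF r(1)]
    proof eventually_elim
      case (elim q)
      then have "\<Psi> r \<le> \<Psi> q" using r by (intro prim_antimono) auto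
      then show ?case using r(3) by (meson ereal_less_eq(3) order_less_le_trans)
    qed
  qed
  then show ?thesis
    unfolding ext_prim_def by (simp add: tendsto_Lim)
qed

lemma ext_prim_strict_antimono:
  assumes "0 \<le> a" "a < b" "b < r0"
  shows "ext_prim \<Psi> b < ext_prim \<Psi> a"
proof (cases "a = 0")
  case True
  \<comment> \<open>An intermediate point gives strictness, which the supremum alone does
    not.\<close>
  have "ext_prim \<Psi> b < ereal (\<Psi> (b / 2))"
    using assms prim_strict_antimono[of "b / 2" b] by (simp add: ext_prim_def)
  also have "\<dots> \<le> ext_prim \<Psi> 0"
    unfolding ext_prim_0 using assms by (intro SUP_upper) auto
  finally show ?thesis using True by simp
next
  case False
  then show ?thesis
    using assms prim_strict_antimono[of a b] by (simp add: ext_prim_def)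
qed

lemma ext_prim_le_iff:
  assumes "0 \<le> a" "a < r0" "0 \<le> b" "b < r0"
  shows "ext_prim \<Psi> a \<le> ext_prim \<Psi> b \<longleftrightarrow> b \<le> a"
  using assms ext_prim_strict_antimono[of a b] ext_prim_strict_antimono[of b a]
  by (cases a b rule: linorder_cases) auto

text \<open>Either the default value 0 applies, or \<tau> lies in the image of the extended
  primitive, so that \<open>inv_into\<close> is a true inverse there. The image is reached by the
  intermediate value theorem.\<close>

lemma prim_inv_cases:
  assumes s0: "0 \<le> s0" "s0 < r0" and "0 \<le> a"
  defines "\<tau> \<equiv> ereal a + ext_prim \<Psi> s0"
  obtains "ext_prim \<Psi> 0 \<le> \<tau>" "prim_inv r0 \<Psi> \<tau> = 0"
  | "0 \<le> prim_inv r0 \<Psi> \<tau>" "prim_inv r0 \<Psi> \<tau> < r0" "ext_prim \<Psi> (prim_inv r0 \<Psi> \<tau>) = \<tau>"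
proof (cases "ext_prim \<Psi> 0 \<le> \<tau>")
  case True
  then show ?thesis by (intro that(1)) (simp_all add: prim_inv_def)
next
  case False
  have "s0 \<noteq> 0"
  proof
    assume "s0 = 0"
    then have "0 + ext_prim \<Psi> 0 \<le> \<tau>"
      unfolding \<tau>_def using \<open>0 \<le> a\<close> by (intro add_mono) simp_all
    with False show False by simp
  qed
  then have \<tau>: "\<tau> = ereal (a + \<Psi> s0)"
    by (simp add: \<tau>_def ext_prim_def)
  \<comment> \<open>As \<tau> is below the supremum, some value of \<Psi> exceeds it; \<tau> is then
    taken between \<open>r\<close> and \<open>s0\<close>.\<close>
  obtain r where r: "0 < r" "r < r0" "a + \<Psi> s0 < \<Psi> r"
    using False unfolding ext_prim_0 \<tau> by (auto simp: not_le less_SUP_iff)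
  have "r < s0"
    using r s0 \<open>0 \<le> a\<close> \<open>s0 \<noteq> 0\<close> prim_antimono[of s0 r] by force
  have "continuous_on {r..s0} \<Psi>"
    using r s0 by (intro DERIV_continuous_on[OF has_field_derivative_at_within[OF DERIV_prim]]) auto
  then obtain x where x: "r \<le> x" "x \<le> s0" "\<Psi> x = a + \<Psi> s0"
    using IVT2'[of \<Psi> s0 "a + \<Psi> s0" r] r \<open>r < s0\<close> \<open>0 \<le> a\<close> by auto
  then have "\<tau> \<in> ext_prim \<Psi> ` {0..<r0}"
    using r s0 by (intro image_eqI[of _ _ x]) (auto simp: ext_prim_def \<tau>)
  moreover have "prim_inv r0 \<Psi> \<tau> = inv_into {0..<r0} (ext_prim \<Psi>) \<tau>"
    using False by (simp add: prim_inv_def)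
  ultimately show ?thesis
    using inv_into_into[of \<tau> "ext_prim \<Psi>" "{0..<r0}"] f_inv_into_f[of \<tau> "ext_prim \<Psi>" "{0..<r0}"]
    by (intro that(2)) auto
qed

lemma prim_inv_bounds:
  assumes "0 \<le> s0" "s0 < r0" "0 \<le> a"
  shows "0 \<le> prim_inv r0 \<Psi> (ereal a + ext_prim \<Psi> s0)" "prim_inv r0 \<Psi> (ereal a + ext_prim \<Psi> s0) < r0"
  using r0_pos by (auto intro: prim_inv_cases[OF assms])

text \<open>Turns a lower bound on \<Psi> of the loss into the rate for the loss itself.\<close>

lemma le_prim_inv:
  assumes "0 \<le> s0" "s0 < r0" "0 \<le> a" and s: "0 \<le> s" "s < r0"
    and "ereal a + ext_prim \<Psi> s0 \<le> ext_prim \<Psi> s"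
  shows "s \<le> prim_inv r0 \<Psi> (ereal a + ext_prim \<Psi> s0)"
proof (cases rule: prim_inv_cases[OF assms(1-3)])
  case 1
  then have "ext_prim \<Psi> 0 \<le> ext_prim \<Psi> s" using assms(6) by simp
  then show ?thesis using ext_prim_le_iff[of 0 s] s r0_pos 1(2) by simp
next
  case 2
  then show ?thesis using ext_prim_le_iff[OF 2(1,2) s] assms(6) by simp
qed

text \<open>Ekeland's argument: a minimizer \<open>z1\<close> of \<open>\<psi> (f z) + c \<parallel>z - z0\<parallel>\<close> with \<open>c < 1\<close> must satisfy
  \<open>f z1 = 0\<close>, as the slope of \<open>\<psi> \<circ> f\<close> is at least \<open>1\<close> elsewhere.\<close>

lemma KL_error_bound:
  fixes f :: "'a::euclidean_space \<Rightarrow> real"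
  assumes diff: "\<And>z. f differentiable (at z)" and f_nonneg: "\<And>z. 0 \<le> f z"
    and KL: "\<And>z. 0 < f z \<Longrightarrow> f z < r0 \<Longrightarrow> 1 \<le> deriv \<psi> (f z) * norm (grad f z)"
    and y: "\<And>z. f z = 0 \<Longrightarrow> z = y"
    and z0: "f z0 < r0"
  shows "norm (z0 - y) \<le> \<psi> (f z0)"
\<comment> \<open>The factor \<open>c < 1\<close> leaves a gap to the slope bound 1, hence strict
  descent; the claim follows on letting \<open>c\<close> tend to 1.\<close>
proof (rule field_le_mult_one_interval)
  fix c :: real assume c: "0 < c" "c < 1"
  define h where "h z = \<psi> (f z) + c * norm (z - z0)" for z
  \<comment> \<open>The sublevel set keeps \<open>f\<close> below \<open>r0\<close>, where \<psi> is
    continuous; the ball gives compactness and contains every point of that sublevel set where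
    \<open>h\<close> is at most \<open>h z0\<close>.\<close>
  define K where "K = {z. f z \<le> f z0} \<inter> cball z0 (\<psi> (f z0) / c)"
  have cont_f: "continuous_on S f" for S
    by (intro continuous_at_imp_continuous_on ballI differentiable_imp_continuous_within diff)
  have "compact K"
    unfolding K_def by (intro closed_Int_compact closed_Collect_le cont_f continuous_intros compact_cball)
  moreover have "z0 \<in> K"
    unfolding K_def using c nonneg[OF f_nonneg z0] by simp
  moreover have "continuous_on K h"
    unfolding h_def using f_nonneg z0
    by (intro continuous_intros continuous_on_compose2[OF continuous cont_f]) (auto simp: K_def)
  ultimately obtain z1 where z1: "z1 \<in> K" and min: "\<And>z. z \<in> K \<Longrightarrow> h z1 \<le> h z"
    using continuous_attains_inf[of K h] by blast
  have hz1: "h z1 \<le> \<psi> (f z0)"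
    using min[OF \<open>z0 \<in> K\<close>] by (simp add: h_def)
  have "f z1 = 0"
  proof (rule ccontr)
    assume "f z1 \<noteq> 0"
    then have f1: "0 < f z1" "f z1 < r0" "f z1 \<le> f z0"
      using f_nonneg[of z1] z1 z0 by (auto simp: K_def)
    define G where "G = grad f z1"
    \<comment> \<open>Unit direction of steepest descent: along it \<psi> of \<open>f\<close> falls
      at rate at least 1, while the penalty grows at rate at most \<open>c\<close>.\<close>
    define v where "v = - (G /\<^sub>R norm G)"
    define p where "p s = z1 + s *\<^sub>R v" for s
    have slope: "1 \<le> deriv \<psi> (f z1) * norm G"
      unfolding G_def using KL f1 by blast
    then have "G \<noteq> 0" by auto
    then have vG: "v \<bullet> G = - norm G" and "norm v = 1"
      by (auto simp: v_def power2_norm_eq_inner[symmetric] power2_eq_square)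
    have p': "(p has_vector_derivative v) (at 0)"
      unfolding p_def by (auto intro!: derivative_eq_intros)
    have "GDERIV f (p 0) :> G"
      using differentiable_imp_GDERIV[OF diff] by (simp add: p_def G_def)
    then have fp': "((\<lambda>s. f (p s)) has_real_derivative - norm G) (at 0)"
      using DERIV_compose_curve[OF _ p'] vG by metis
    have "((\<lambda>s. \<psi> (f (p s))) has_real_derivative deriv \<psi> (f z1) * - norm G) (at 0)"
      using DERIV_psi[OF f1(1,2)] by (intro DERIV_chain2[OF _ fp']) (simp add: p_def)
    then have "((\<lambda>s. \<psi> (f (p s)) + c * s) has_real_derivative deriv \<psi> (f z1) * - norm G + c) (at 0)"
      by (auto intro!: derivative_eq_intros)
    moreover have "deriv \<psi> (f z1) * - norm G + c < 0"
      using slope c by simp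
    ultimately obtain d1 where d1: "0 < d1"
      "\<And>s. 0 < s \<Longrightarrow> s < d1 \<Longrightarrow> \<psi> (f (p (0 + s))) + c * (0 + s) < \<psi> (f (p 0)) + c * 0"
      using DERIV_neg_dec_right by blast
    obtain d2 where d2: "0 < d2" "\<And>s. 0 < s \<Longrightarrow> s < d2 \<Longrightarrow> f (p (0 + s)) < f (p 0)"
      using DERIV_neg_dec_right[OF fp'] \<open>G \<noteq> 0\<close> by auto
    \<comment> \<open>A step short enough to decrease both the penalized quantity and
      \<open>f\<close>; the latter keeps the new point in the sublevel set.\<close>
    define s where "s = min d1 d2 / 2"
    have s: "0 < s" "s < d1" "s < d2" using d1(1) d2(1) by (auto simp: s_def)
    have fps: "f (p s) < f z1" "\<psi> (f (p s)) + c * s < \<psi> (f z1)"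
      using d1(2)[OF s(1,2)] d2(2)[OF s(1,3)] by (simp_all add: p_def)
    have "norm (p s - z0) \<le> norm (z1 - z0) + s"
      using norm_triangle_ineq[of "z1 - z0" "s *\<^sub>R v"] s(1) \<open>norm v = 1\<close>
      by (simp add: p_def algebra_simps)
    then have "c * norm (p s - z0) \<le> c * norm (z1 - z0) + c * s"
      using c by (simp add: distrib_left[symmetric])
    then have less: "h (p s) < h z1"
      using fps(2) by (simp add: h_def)
    have "c * norm (p s - z0) \<le> \<psi> (f z0)"
      using less hz1 nonneg[OF f_nonneg, of "p s"] fps(1) f1(2) by (simp add: h_def)
    then have "p s \<in> K"
      using c fps(1) f1(3) by (simp add: K_def dist_norm norm_minus_commute field_simps)
    with min less show False by force
  qed
  then show "c * norm (z0 - y) \<le> \<psi> (f z0)"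
    using hz1 y[of z1] by (simp add: h_def zero norm_minus_commute)
qed

end

section \<open>Gradient flows under a KL inequality\<close>

text \<open>The slope bound is assumed only while the trajectory stays within \<rho> of its start;
  \<open>radius\<close> is the strict inequality that lets it never leave.\<close>

locale KL_gradient_flow = desingularizer +
  fixes f :: "'a::euclidean_space \<Rightarrow> real" and \<theta> :: "real \<Rightarrow> 'a" and k \<rho> :: real
  assumes f_differentiable: "\<And>z. f differentiable (at z)"
    and f_nonneg: "\<And>z. 0 \<le> f z"
    and f_init: "f (\<theta> 0) < r0"
    and flow: "\<And>t. 0 \<le> t \<Longrightarrow> (\<theta> has_vector_derivative - grad f (\<theta> t)) (at t within {0..})"
    and k_pos: "0 < k"
    and slope: "\<And>t. 0 \<le> t \<Longrightarrow> dist (\<theta> 0) (\<theta> t) \<le> \<rho> \<Longrightarrow> 0 < f (\<theta> t) \<Longrightarrow> f (\<theta> t) < r0 \<Longrightarrow>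
      k \<le> deriv \<psi> (f (\<theta> t)) * norm (grad f (\<theta> t))"
    and radius: "\<psi> (f (\<theta> 0)) / k < \<rho>"
begin

lemma continuous_on_flow: "S \<subseteq> {0..} \<Longrightarrow> continuous_on S \<theta>"
  using flow by (meson atLeast_iff continuous_on_eq_continuous_within continuous_on_subset
      has_vector_derivative_continuous)

lemma flow_at: "0 < t \<Longrightarrow> (\<theta> has_vector_derivative - grad f (\<theta> t)) (at t)"
  using flow[of t] by (simp add: at_within_interior[of t "{0..}"])

lemma continuous_on_loss: "S \<subseteq> {0..} \<Longrightarrow> continuous_on S (\<lambda>t. f (\<theta> t))"
  by (intro continuous_on_compose2[OF _ continuous_on_flow, of UNIV f])
    (auto intro!: continuous_at_imp_continuous_on differentiable_imp_continuous_within f_differentiable)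

lemma DERIV_loss: "0 < t \<Longrightarrow> ((\<lambda>t. f (\<theta> t)) has_real_derivative - (norm (grad f (\<theta> t)))\<^sup>2) (at t)"
  using DERIV_compose_curve[OF differentiable_imp_GDERIV[OF f_differentiable] flow_at]
  by (simp add: power2_norm_eq_inner)

lemma loss_antimono:
  assumes "0 \<le> s" "s \<le> t"
  shows "f (\<theta> t) \<le> f (\<theta> s)"
  using assms(2)
proof (rule DERIV_nonpos_imp_decreasing_open)
  fix x assume "s < x"
  then show "\<exists>y. ((\<lambda>t. f (\<theta> t)) has_real_derivative y) (at x) \<and> y \<le> 0"
    using DERIV_loss[of x] assms by (intro exI[of _ "- (norm (grad f (\<theta> x)))\<^sup>2"]) auto
qed (use assms in \<open>auto intro!: continuous_on_loss\<close>)

lemma loss_less: "0 \<le> t \<Longrightarrow> f (\<theta> t) < r0"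
  using loss_antimono[of 0 t] f_init by simp

lemma grad_eq_0_at_zero:
  assumes "f z = 0"
  shows "grad f z = 0"
proof -
  have D: "(f has_derivative (\<lambda>h. h \<bullet> grad f z)) (at z)"
    using differentiable_imp_GDERIV[OF f_differentiable] by (simp add: gderiv_def)
  have "(\<lambda>h. h \<bullet> grad f z) = (\<lambda>h. 0)"
    by (rule differential_zero_maxmin[OF UNIV_I open_UNIV D]) (simp add: assms f_nonneg)
  then have "grad f z \<bullet> grad f z = 0" by metis
  then show ?thesis by simp
qed

text \<open>The loss stays at its minimum 0, where the gradient vanishes, so the velocity is zero;
  uniqueness of solutions is not invoked.\<close>

lemma flow_constant_after_zero:
  assumes "0 \<le> s" "s \<le> t" "f (\<theta> s) = 0"
  shows "\<theta> t = \<theta> s"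
proof (cases "s = t")
  case False
  have "f (\<theta> x) = 0" if "s < x" for x
    using loss_antimono[of s x] f_nonneg[of "\<theta> x"] assms that by auto
  then have "(\<theta> has_vector_derivative 0) (at x)" if "s < x" for x
    using flow_at[of x] grad_eq_0_at_zero[of "\<theta> x"] assms(1) that by simp
  then have "norm (\<theta> t - \<theta> s) \<le> (\<lambda>_. 0) t - (\<lambda>_. 0) s"
    using assms False
    by (intro differentiable_bound_general[where f' = "\<lambda>_. 0" and \<phi>' = "\<lambda>_. 0"] continuous_on_flow)
      auto
  then show ?thesis by simp
qed simp

lemma continuous_on_psi_loss: "S \<subseteq> {0..} \<Longrightarrow> continuous_on S (\<lambda>t. \<psi> (f (\<theta> t)))"
  by (intro continuous_on_compose2[OF continuous continuous_on_loss])
    (auto simp: f_nonneg intro!: loss_less)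

text \<open>The function \<open>?V\<close> grows at least as fast as the speed of the curve.
  Positivity is asked for because \<psi> need not be differentiable at 0; at the end points
  continuity is enough.\<close>

lemma length_le_positive:
  assumes "0 \<le> s" "s \<le> t"
    and ball: "\<And>x. s < x \<Longrightarrow> x < t \<Longrightarrow> dist (\<theta> 0) (\<theta> x) \<le> \<rho>"
    and pos: "\<And>x. s < x \<Longrightarrow> x < t \<Longrightarrow> 0 < f (\<theta> x)"
  shows "norm (\<theta> t - \<theta> s) \<le> (\<psi> (f (\<theta> s)) - \<psi> (f (\<theta> t))) / k"
proof (cases "s = t")
  case False
  let ?n = "\<lambda>x. norm (grad f (\<theta> x))"
  let ?V = "\<lambda>x. - \<psi> (f (\<theta> x)) / k"
  have "norm (\<theta> t - \<theta> s) \<le> ?V t - ?V s"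
  proof (rule differentiable_bound_general[where f' = "\<lambda>x. - grad f (\<theta> x)"
        and \<phi>' = "\<lambda>x. deriv \<psi> (f (\<theta> x)) * (?n x)\<^sup>2 / k"])
    show "s < t" using assms False by simp
    show "continuous_on {s..t} \<theta>" "continuous_on {s..t} ?V"
      using assms(1) k_pos by (auto intro!: continuous_intros continuous_on_flow continuous_on_psi_loss)
    fix x assume x: "s < x" "x < t"
    then have "0 < x" using assms by simp
    show "(\<theta> has_vector_derivative - grad f (\<theta> x)) (at x)"
      using flow_at[OF \<open>0 < x\<close>] .
    have fx: "0 < f (\<theta> x)" "f (\<theta> x) < r0"
      using pos[OF x] loss_less[of x] \<open>0 < x\<close> by auto
    have "((\<lambda>x. \<psi> (f (\<theta> x))) has_real_derivative deriv \<psi> (f (\<theta> x)) * - (?n x)\<^sup>2) (at x)"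
      using DERIV_psi[OF fx] DERIV_loss[OF \<open>0 < x\<close>] by (rule DERIV_chain2)
    then have "(?V has_real_derivative - (deriv \<psi> (f (\<theta> x)) * - (?n x)\<^sup>2) / k) (at x)"
      by (intro DERIV_cdivide DERIV_minus)
    then show "(?V has_vector_derivative deriv \<psi> (f (\<theta> x)) * (?n x)\<^sup>2 / k) (at x)"
      by (simp add: has_real_derivative_iff_has_vector_derivative)
    have "k \<le> deriv \<psi> (f (\<theta> x)) * ?n x"
      using \<open>0 < x\<close> fx ball[OF x] by (intro slope) auto
    then have "k * ?n x \<le> deriv \<psi> (f (\<theta> x)) * ?n x * ?n x"
      by (rule mult_right_mono) simp
    then show "norm (- grad f (\<theta> x)) \<le> deriv \<psi> (f (\<theta> x)) * (?n x)\<^sup>2 / k"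
      using k_pos by (simp add: field_simps power2_eq_square)
  qed
  then show ?thesis by (simp add: diff_divide_distrib)
qed simp

text \<open>Splitting at the first zero \<open>T\<close> of the loss: before it the previous bound
  applies, after it the trajectory is at rest.\<close>

lemma length_le_in_ball:
  assumes "0 \<le> s" "s \<le> t" and ball: "\<And>x. s < x \<Longrightarrow> x < t \<Longrightarrow> dist (\<theta> 0) (\<theta> x) \<le> \<rho>"
  shows "norm (\<theta> t - \<theta> s) \<le> (\<psi> (f (\<theta> s)) - \<psi> (f (\<theta> t))) / k"
proof -
  define Z where "Z = {x \<in> {s..t}. f (\<theta> x) = 0}"
  show ?thesis
  proof (cases "Z = {}")
    case True
    then show ?thesis
      using assms f_nonneg by (intro length_le_positive ball) (auto simp: Z_def order.strict_iff_order)
  next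
    case False
    have "compact Z"
      unfolding Z_def compact_eq_bounded_closed using assms(1)
      by (intro conjI continuous_closed_preimage_constant continuous_on_loss bounded_subset[OF bounded_closed_interval]) auto
    then obtain T where T: "T \<in> Z" "\<And>x. x \<in> Z \<Longrightarrow> T \<le> x"
      using compact_attains_inf[OF _ False] by blast
    then have sT: "s \<le> T" "T \<le> t" "f (\<theta> T) = 0" by (auto simp: Z_def)
    have "norm (\<theta> T - \<theta> s) \<le> (\<psi> (f (\<theta> s)) - \<psi> (f (\<theta> T))) / k"
    proof (intro length_le_positive)
      fix x assume "s < x" "x < T"
      then show "0 < f (\<theta> x)"
        using T(2)[of x] sT f_nonneg[of "\<theta> x"] by (force simp: Z_def order.strict_iff_order)
    qed (use assms(1) sT ball in auto)
    moreover have "\<theta> t = \<theta> T"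
      using assms(1) sT by (intro flow_constant_after_zero) auto
    ultimately show ?thesis by simp
  qed
qed

text \<open>At the first time the trajectory would leave the ball of radius \<open>\<rho>\<close>, the length bound still
  confines it to the strictly smaller ball of radius \<open>\<psi> (f (\<theta> 0)) / k\<close>.\<close>

lemma flow_trapped:
  assumes "0 \<le> t"
  shows "dist (\<theta> 0) (\<theta> t) \<le> \<rho>"
proof (rule ccontr)
  assume out: "\<not> dist (\<theta> 0) (\<theta> t) \<le> \<rho>"
  \<comment> \<open>The closed condition makes \<open>Z\<close> compact, so a first such time
    exists.\<close>
  define Z where "Z = {x \<in> {0..t}. dist (\<theta> 0) (\<theta> x) \<in> {\<rho>..}}"
  have "compact Z"
    unfolding Z_def compact_eq_bounded_closed
    by (intro conjI continuous_closed_preimage[unfolded vimage_def Int_def mem_Collect_eq]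
        continuous_intros continuous_on_flow bounded_subset[OF bounded_closed_interval]) auto
  moreover have "t \<in> Z" using out assms by (simp add: Z_def)
  ultimately obtain T where T: "T \<in> Z" "\<And>x. x \<in> Z \<Longrightarrow> T \<le> x"
    using compact_attains_inf[of Z] by blast
  then have T0: "0 \<le> T" "T \<le> t" "\<rho> \<le> dist (\<theta> 0) (\<theta> T)" by (auto simp: Z_def)
  have "dist (\<theta> 0) (\<theta> x) \<le> \<rho>" if "0 < x" "x < T" for x
    using T(2)[of x] that T0 by (force simp: Z_def)
  then have "norm (\<theta> T - \<theta> 0) \<le> (\<psi> (f (\<theta> 0)) - \<psi> (f (\<theta> T))) / k"
    using T0 by (intro length_le_in_ball) auto
  also have "\<dots> \<le> \<psi> (f (\<theta> 0)) / k"
    using k_pos nonneg[OF f_nonneg loss_less[OF T0(1)]] by (simp add: divide_right_mono)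
  finally show False
    using radius T0(3) by (simp add: dist_norm norm_minus_commute)
qed

lemma length_le:
  assumes "0 \<le> s" "s \<le> t"
  shows "norm (\<theta> t - \<theta> s) \<le> (\<psi> (f (\<theta> s)) - \<psi> (f (\<theta> t))) / k"
  using assms by (intro length_le_in_ball flow_trapped) auto

lemma dist_init_le:
  assumes "0 \<le> t"
  shows "dist (\<theta> 0) (\<theta> t) \<le> \<psi> (f (\<theta> 0)) / k"
proof -
  have "dist (\<theta> 0) (\<theta> t) \<le> (\<psi> (f (\<theta> 0)) - \<psi> (f (\<theta> t))) / k"
    using length_le[of 0 t] assms by (simp add: dist_norm norm_minus_commute)
  also have "\<dots> \<le> \<psi> (f (\<theta> 0)) / k"
    using k_pos nonneg[OF f_nonneg loss_less[OF assms]] by (simp add: divide_right_mono)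
  finally show ?thesis .
qed

text \<open>The derivative of \<Psi> along the loss is the square of \<psi>' times the gradient
  norm, which the slope bound keeps above \<open>k\<^sup>2\<close>. Monotonicity makes the loss
  positive on all of \<open>{0..t}\<close>.\<close>

lemma prim_loss_ge:
  assumes "0 \<le> t" "0 < f (\<theta> t)"
  shows "k\<^sup>2 * t + \<Psi> (f (\<theta> 0)) \<le> \<Psi> (f (\<theta> t))"
proof -
  let ?n = "\<lambda>x. norm (grad f (\<theta> x))"
  have pos: "0 < f (\<theta> x)" "f (\<theta> x) < r0" if "0 \<le> x" "x \<le> t" for x
    using loss_antimono[OF that] loss_less[OF that(1)] assms by auto
  have "\<Psi> (f (\<theta> 0)) - k\<^sup>2 * 0 \<le> \<Psi> (f (\<theta> t)) - k\<^sup>2 * t"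
    using assms(1)
  proof (rule DERIV_nonneg_imp_increasing_open[where f = "\<lambda>x. \<Psi> (f (\<theta> x)) - k\<^sup>2 * x"])
    have "continuous_on {0<..<r0} \<Psi>"
      by (intro DERIV_continuous_on[OF has_field_derivative_at_within[OF DERIV_prim]]) auto
    then show "continuous_on {0..t} (\<lambda>x. \<Psi> (f (\<theta> x)) - k\<^sup>2 * x)"
      using pos by (intro continuous_intros continuous_on_compose2[OF _ continuous_on_loss]) auto
    fix x assume x: "0 < x" "x < t"
    then have fx: "0 < f (\<theta> x)" "f (\<theta> x) < r0" using pos[of x] by auto
    have "((\<lambda>x. \<Psi> (f (\<theta> x))) has_real_derivative - (deriv \<psi> (f (\<theta> x)))\<^sup>2 * - (?n x)\<^sup>2) (at x)"
      using DERIV_prim[OF fx] DERIV_loss[OF x(1)] by (rule DERIV_chain2)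
    then have "((\<lambda>x. \<Psi> (f (\<theta> x)) - k\<^sup>2 * x) has_real_derivative
        - (deriv \<psi> (f (\<theta> x)))\<^sup>2 * - (?n x)\<^sup>2 - k\<^sup>2) (at x)"
      by (auto intro!: derivative_eq_intros)
    moreover have "k\<^sup>2 \<le> (deriv \<psi> (f (\<theta> x)) * ?n x)\<^sup>2"
      using x fx k_pos by (intro power_mono slope flow_trapped) auto
    ultimately show "\<exists>y. ((\<lambda>x. \<Psi> (f (\<theta> x)) - k\<^sup>2 * x) has_real_derivative y) (at x) \<and> 0 \<le> y"
      by (auto simp: power_mult_distrib)
  qed
  then show ?thesis by simp
qed

lemma ext_prim_loss_ge:
  assumes "0 \<le> t" "0 < f (\<theta> t)"
  shows "ereal (k\<^sup>2 * t) + ext_prim \<Psi> (f (\<theta> 0)) \<le> ext_prim \<Psi> (f (\<theta> t))"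
  using prim_loss_ge[OF assms] loss_antimono[of 0 t] assms by (simp add: ext_prim_def)

lemma loss_le_prim_inv:
  assumes "0 \<le> t"
  shows "f (\<theta> t) \<le> prim_inv r0 \<Psi> (ereal (k\<^sup>2 * t) + ext_prim \<Psi> (f (\<theta> 0)))"
proof (cases "f (\<theta> t) = 0")
  case True
  then show ?thesis
    using prim_inv_bounds(1)[OF f_nonneg f_init] assms by simp
next
  case False
  then have "0 < f (\<theta> t)" using f_nonneg[of "\<theta> t"] by simp
  then show ?thesis
    using assms by (intro le_prim_inv f_nonneg f_init loss_less ext_prim_loss_ge) auto
qed

lemma loss_le_of_ext_prim_le:
  assumes "0 \<le> t" "0 \<le> s" "s < r0" "ext_prim \<Psi> s \<le> ereal (k\<^sup>2 * t) + ext_prim \<Psi> (f (\<theta> 0))"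
  shows "f (\<theta> t) \<le> s"
proof (cases "f (\<theta> t) = 0")
  case False
  then have "0 < f (\<theta> t)" using f_nonneg[of "\<theta> t"] by simp
  then show ?thesis
    using assms order_trans[OF assms(4) ext_prim_loss_ge] ext_prim_le_iff[of s "f (\<theta> t)"]
      loss_less[of t] by simp
qed (use assms in simp)

lemma loss_tendsto_0: "((\<lambda>t. f (\<theta> t)) \<longlongrightarrow> 0) at_top"
proof (rule tendstoI)
  fix \<epsilon> :: real assume "0 < \<epsilon>"
  define s where "s = min \<epsilon> r0 / 2"
  have s: "0 < s" "s < r0" "s < \<epsilon>" using \<open>0 < \<epsilon>\<close> r0_pos by (auto simp: s_def)
  \<comment> \<open>By this time the lower bound on \<Psi> has passed level
    \<open>\<Psi> s\<close>.\<close>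
  have "\<forall>\<^sub>F t in at_top. max 0 ((\<Psi> s - \<Psi> (f (\<theta> 0))) / k\<^sup>2) \<le> t"
    by (rule eventually_ge_at_top)
  then show "\<forall>\<^sub>F t in at_top. dist (f (\<theta> t)) 0 < \<epsilon>"
  proof eventually_elim
    case (elim t)
    have "f (\<theta> t) \<le> s"
    proof (cases "f (\<theta> t) = 0")
      case False
      then have pos: "0 < f (\<theta> t)" using f_nonneg[of "\<theta> t"] by simp
      have "\<Psi> s \<le> k\<^sup>2 * t + \<Psi> (f (\<theta> 0))"
        using elim k_pos by (simp add: field_simps)
      then show ?thesis
        using pos elim loss_antimono[of 0 t] s
        by (intro loss_le_of_ext_prim_le) (auto simp: ext_prim_def)
    qed (use s in simp)
    then show ?case using f_nonneg[of "\<theta> t"] s by simp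
  qed
qed

lemma psi_loss_tendsto_0: "((\<lambda>t. \<psi> (f (\<theta> t))) \<longlongrightarrow> 0) at_top"
proof -
  have "\<forall>\<^sub>F t in at_top. f (\<theta> t) \<in> {0..<r0}"
    using eventually_ge_at_top[of "0::real"] by eventually_elim (simp add: f_nonneg loss_less)
  from continuous_on_tendsto_compose[OF continuous loss_tendsto_0 _ this] show ?thesis
    using r0_pos zero by simp
qed

text \<open>The remaining length after time \<open>s\<close> is at most \<psi> of the loss over
  \<open>k\<close>, which tends to 0. Integer times thus form a Cauchy sequence; its limit inherits
  the tail bound, and this gives convergence in continuous time.\<close>

lemma flow_converges:
  obtains \<theta>_lim where "(\<theta> \<longlongrightarrow> \<theta>_lim) at_top" "f \<theta>_lim = 0"
    "\<And>t. 0 \<le> t \<Longrightarrow> norm (\<theta> t - \<theta>_lim) \<le> \<psi> (f (\<theta> t)) / k"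
proof -
  have psi_k: "((\<lambda>t. \<psi> (f (\<theta> t)) / k) \<longlongrightarrow> 0) at_top"
    using tendsto_divide[OF psi_loss_tendsto_0 tendsto_const[of k]] k_pos by simp
  have tail: "norm (\<theta> t - \<theta> s) \<le> \<psi> (f (\<theta> s)) / k" if "0 \<le> s" "s \<le> t" for s t
  proof -
    have "(\<psi> (f (\<theta> s)) - \<psi> (f (\<theta> t))) / k \<le> \<psi> (f (\<theta> s)) / k"
      using k_pos nonneg[OF f_nonneg loss_less[of t]] that by (simp add: divide_right_mono)
    then show ?thesis using length_le[OF that] by simp
  qed
  have "Cauchy (\<lambda>n. \<theta> (real n))"
  proof (rule CauchyI')
    fix \<epsilon> :: real assume "0 < \<epsilon>"
    then have "\<forall>\<^sub>F t in at_top. \<psi> (f (\<theta> t)) / k < \<epsilon> \<and> 0 \<le> t"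
      by (intro eventually_conj order_tendstoD(2)[OF psi_k] eventually_ge_at_top)
    then obtain M where M: "\<And>t. M \<le> t \<Longrightarrow> \<psi> (f (\<theta> t)) / k < \<epsilon> \<and> 0 \<le> t"
      unfolding eventually_at_top_linorder by blast
    show "\<exists>M. \<forall>m\<ge>M. \<forall>n>m. dist (\<theta> (real m)) (\<theta> (real n)) < \<epsilon>"
    proof (intro exI allI impI)
      fix m n assume "nat \<lceil>M\<rceil> \<le> m" "m < n"
      then have "M \<le> real m" by linarith
      then show "dist (\<theta> (real m)) (\<theta> (real n)) < \<epsilon>"
        using M[of "real m"] tail[of "real m" "real n"] \<open>m < n\<close>
        by (simp add: dist_norm norm_minus_commute)
    qed
  qed
  then obtain l where l: "(\<lambda>n. \<theta> (real n)) \<longlonglongrightarrow> l"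
    using Cauchy_convergent_iff convergent_def by blast
  have rate: "norm (\<theta> t - l) \<le> \<psi> (f (\<theta> t)) / k" if "0 \<le> t" for t
  proof (rule tendsto_upperbound)
    show "(\<lambda>n. norm (\<theta> t - \<theta> (real n))) \<longlonglongrightarrow> norm (\<theta> t - l)"
      by (intro tendsto_intros l)
    have "\<forall>\<^sub>F n in sequentially. t \<le> real n"
      using filterlim_real_sequentially unfolding filterlim_at_top by blast
    then show "\<forall>\<^sub>F n in sequentially. norm (\<theta> t - \<theta> (real n)) \<le> \<psi> (f (\<theta> t)) / k"
      by eventually_elim (simp add: tail that norm_minus_commute[of "\<theta> t"])
  qed simp
  have "((\<lambda>t. \<theta> t - l) \<longlongrightarrow> 0) at_top"
    by (rule Lim_null_comparison[OF eventually_mono[OF eventually_ge_at_top[of 0] rate] psi_k])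
  then have lim: "(\<theta> \<longlongrightarrow> l) at_top"
    by (simp add: LIM_zero_iff)
  have "isCont f l"
    using differentiable_imp_continuous_within[OF f_differentiable] .
  then have "((\<lambda>t. f (\<theta> t)) \<longlongrightarrow> f l) at_top"
    using lim by (rule isCont_tendsto_compose)
  then have "f l = 0"
    using loss_tendsto_0 tendsto_unique trivial_limit_at_top_linorder by blast
  with lim rate that show ?thesis by blast
qed

end

section \<open>Constants of the forward operator\<close>

lemma sigma_F_mult_norm_le:
  assumes "x \<in> S" "z \<in> range ((*v) (jacobian F (at x)))"
  shows "sigma_F F S * norm z \<le> norm (transpose (jacobian F (at x)) *v z)"
proof (cases "z = 0")
  case False
  then have "sigma_F F S \<le> norm (transpose (jacobian F (at x)) *v z) / norm z"
    unfolding sigma_F_def using assms by (intro cInf_lower bdd_belowI[of _ 0]) auto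
  then show ?thesis using False by (simp add: field_simps)
qed simp

lemma mu_F_mult_norm_le:
  assumes "x \<in> S"
  shows "mu_F F S p * norm (x - p) \<le> norm (F x - F p)"
proof (cases "x = p")
  case False
  then have "mu_F F S p \<le> norm (F x - F p) / norm (x - p)"
    unfolding mu_F_def using assms by (intro cInf_lower bdd_belowI[of _ 0]) auto
  then show ?thesis using False by (simp add: field_simps)
qed simp

text \<open>Mean value inequality on a convex ball. Continuity of the Jacobian on this compact set
  bounds its entries, so the supremum in \<open>L_F\<close> is over a bounded set.\<close>

lemma norm_diff_le_L_F:
  fixes F :: "real^'n \<Rightarrow> real^'m"
  assumes F: "C1_map F" and "norm x \<le> 2 * norm xbar" "norm y \<le> 2 * norm xbar"
  shows "norm (F x - F y) \<le> L_F F xbar * norm (x - y)"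
proof -
  let ?K = "cball (0 :: real^'n) (2 * norm xbar)"
  have "bounded ((\<lambda>x. jacobian F (at x)) ` ?K)"
    using F unfolding C1_map_def
    by (intro compact_imp_bounded compact_continuous_image compact_cball) (auto intro: continuous_on_subset)
  then obtain b where b: "\<And>x. x \<in> ?K \<Longrightarrow> norm (jacobian F (at x)) \<le> b"
    unfolding bounded_iff by blast
  have "bdd_above ((\<lambda>x. spectral_norm (jacobian F (at x))) ` ?K)"
  proof (rule bdd_aboveI2)
    fix x assume "x \<in> ?K"
    have "\<bar>jacobian F (at x) $ i $ j\<bar> \<le> b" for i j
      using b[OF \<open>x \<in> ?K\<close>] component_le_norm_cart[of "jacobian F (at x) $ i" j]
        Finite_Cartesian_Product.norm_nth_le[of "jacobian F (at x)" i] by linarith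
    then show "spectral_norm (jacobian F (at x)) \<le> real CARD('m) * real CARD('n) * b"
      unfolding spectral_norm_def by (rule onorm_le_matrix_component)
  qed
  then have "spectral_norm (jacobian F (at x)) \<le> L_F F xbar" if "x \<in> ?K" for x
    unfolding L_F_def by (rule cSUP_upper[OF that])
  moreover have "(F has_derivative (*v) (jacobian F (at x))) (at x within ?K)" for x
    using F unfolding C1_map_def by (blast intro: has_derivative_at_withinI jacobian_works[THEN iffD1])
  ultimately show ?thesis
    using assms(2,3) by (intro differentiable_bound[of ?K]) (auto simp: spectral_norm_def)
qed

section \<open>Convergence of the network\<close>

text \<open>\<open>R\<close> is an extended real because a vanishing Lipschitz constant makes it
  infinite. The time threshold in (ii) comes from solving for \<open>t\<close> when \<gamma> reaches
  \<Psi> at the level where \<psi> equals \<open>norm \<epsilon>\<close>, so the factor multiplies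
  the difference of both values of \<Psi>. In (iii) the error bound acts on observations, which
  gives the first term without \<open>2 / (\<sigma> * \<sigma>F)\<close>; the form with this factor
  follows once the factor is at least 1.\<close>

theorem theorem3p2:
  fixes \<phi> :: "real \<Rightarrow> real" and B :: real
    and N :: "nat \<Rightarrow> nat" and L :: nat
    and e :: "param \<Rightarrow> 'p::finite"
    and u :: "real^'d::finite"
    and g :: "real^'p \<Rightarrow> real^'n::finite"
    and F :: "real^'n \<Rightarrow> real^'m::finite"
    and \<epsilon> y :: "real^'m" and xbar :: "real^'n"
    and loss :: "real^'m \<Rightarrow> real"
    and \<psi> \<Psi> :: "real \<Rightarrow> real" and \<eta> r0 L0 :: real
    and \<Theta> :: "(real^'p) set"
    and \<theta> :: "real \<Rightarrow> real^'p" and \<theta>0 :: "real^'p"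
    and xt :: "real \<Rightarrow> real^'n" and yt :: "real \<Rightarrow> real^'m"
    and \<sigma> \<sigma>F R' :: real and R :: ereal
    and \<gamma> :: "real \<Rightarrow> ereal"
    and \<Sigma>' :: "(real^'n) set"
  assumes depth: "1 \<le> L"
    and widths: "\<And>l. l \<le> L \<Longrightarrow> 0 < N l" "N 0 = CARD('d)" "N L = CARD('n)"
    and layout: "bij_betw e (params N L) UNIV"
    and g: "g = network \<phi> N L e u"
    and activation: "\<And>s. \<phi> differentiable (at s)" "continuous_on UNIV (deriv \<phi>)"
      "0 < B" "\<And>s. \<bar>deriv \<phi> s\<bar> \<le> B" "B-lipschitz_on UNIV (deriv \<phi>)"
    and forward: "C1_map F"
      "\<And>S. bounded S \<Longrightarrow> lip_const S (\<lambda>x. jacobian F (at x)) < \<infinity>"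
    and observation: "y = F xbar + \<epsilon>"
    and loss_smooth: "C1_scalar loss"
      "\<And>S. bounded S \<Longrightarrow> \<exists>C. C-lipschitz_on S (grad loss)"
    and loss_min: "\<exists>v. loss v = 0" "\<And>v. 0 \<le> loss v"
    and trajectory: "\<And>t. xt t = g (\<theta> t)" "\<And>t. yt t = F (xt t)"
    and flow: "\<theta> 0 = \<theta>0"
      "\<And>t. 0 \<le> t \<Longrightarrow>
         (\<theta> has_vector_derivative - grad (\<lambda>\<theta>'. loss (F (g \<theta>'))) (\<theta> t)) (at t within {0..})"
    and L0: "L0 = loss (yt 0)"
    and KL: "0 < \<eta>" "r0 = L0 + \<eta>" "KL \<psi> r0 loss"
    and \<Theta>_large: "\<And>t. 0 \<le> t \<Longrightarrow> \<theta> t \<in> \<Theta>"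
    and range: "\<And>x. x \<in> g ` \<Theta> \<Longrightarrow> grad loss (F x) \<in> range ((*v) (jacobian F (at x)))"
    and \<sigma>F: "\<sigma>F = sigma_F F (g ` \<Theta>)" "0 < \<sigma>F"
    and \<sigma>: "\<sigma> = sigma_min (jacobian g (at \<theta>0))" "0 < \<sigma>"
    and R': "R' = 2 / (\<sigma>F * \<sigma>) * \<psi> L0"
    and R: "R = ereal \<sigma> / (2 * lip_const (ecball \<theta>0 R) (\<lambda>\<theta>'. jacobian g (at \<theta>')))"
    and radii: "ereal R' < R"
    and \<Psi>: "primitive_on {0<..<r0} (\<lambda>s. - (deriv \<psi> s)\<^sup>2) \<Psi>"
    and \<gamma>: "\<And>t. \<gamma> t = ereal (\<sigma>F\<^sup>2 * \<sigma>\<^sup>2 / 4 * t) + ext_prim \<Psi> L0"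
    and \<Sigma>': "\<Sigma>' = g ` cball 0 (R' + norm \<theta>0)"
  shows
    "(((\<lambda>t. loss (yt t)) \<longlongrightarrow> 0) at_top \<and>
      (\<forall>t\<ge>0. loss (yt t) \<le> prim_inv r0 \<Psi> (\<gamma> t)) \<and>
      (\<exists>\<theta>inf. (\<theta> \<longlongrightarrow> \<theta>inf) at_top \<and> \<theta>inf \<in> Argmin (\<lambda>\<theta>'. loss (F (g \<theta>'))) \<and>
         (\<forall>t\<ge>0. norm (\<theta> t - \<theta>inf) \<le> 2 / (\<sigma> * \<sigma>F) * \<psi> (prim_inv r0 \<Psi> (\<gamma> t)))))
     \<and>
     (Argmin loss = {y} \<longrightarrow>
        (yt \<longlongrightarrow> y) at_top \<and>
        (convex_on UNIV loss \<longrightarrow>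
          (\<forall>t\<ge>0. ereal t \<ge> ereal (4 / (\<sigma>F\<^sup>2 * \<sigma>\<^sup>2)) *
                      (ext_prim \<Psi> (inv_into {0..<r0} \<psi> (norm \<epsilon>)) - ext_prim \<Psi> L0) \<longrightarrow>
             norm (yt t - F xbar) \<le> 2 * norm \<epsilon>)))
     \<and>
     (\<forall>xp. Argmin loss = {y} \<and> convex_on UNIV loss \<and>
        is_arg_min (\<lambda>z. norm (z - xbar)) (\<lambda>z. z \<in> \<Sigma>') xp \<and> 0 < mu_F F \<Sigma>' xp \<longrightarrow>
        (\<forall>t\<ge>0. norm (xt t - xbar) \<le>
             \<psi> (prim_inv r0 \<Psi> (\<gamma> t)) / mu_F F \<Sigma>' xp
             + (1 + L_F F xbar / mu_F F \<Sigma>' xp) * infdist xbar \<Sigma>' + norm \<epsilon> / mu_F F \<Sigma>' xp) \<and>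
        (\<sigma> * \<sigma>F \<le> 2 \<longrightarrow>
         (\<forall>t\<ge>0. norm (xt t - xbar) \<le>
             2 * \<psi> (prim_inv r0 \<Psi> (\<gamma> t)) / (mu_F F \<Sigma>' xp * \<sigma> * \<sigma>F)
             + (1 + L_F F xbar / mu_F F \<Sigma>' xp) * infdist xbar \<Sigma>' + norm \<epsilon> / mu_F F \<Sigma>' xp)))"
proof -

  \<comment> \<open>Gradient of the composite loss\<close>
  have F_diff: "F differentiable (at x)" for x
    using forward(1) by (simp add: C1_map_def)
  have loss_diff: "loss differentiable (at v)" for v
    using loss_smooth(1) by (simp add: C1_scalar_def)
  have g_diff: "g differentiable (at \<theta>')" for \<theta>'
    unfolding g by (rule differentiable_network[OF activation(1)])
  define f where "f = (\<lambda>\<theta>'. loss (F (g \<theta>')))"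
  have loss_F: "GDERIV (\<lambda>x. loss (F x)) x :> transpose (jacobian F (at x)) *v grad loss (F x)" for x
    by (rule GDERIV_compose_jacobian[OF loss_diff F_diff])
  then have "(\<lambda>x. loss (F x)) differentiable (at x)" for x
    unfolding gderiv_def differentiable_def by blast
  from GDERIV_compose_jacobian[OF this g_diff]
  have f_grad: "GDERIV f \<theta>' :> transpose (jacobian g (at \<theta>')) *v
      (transpose (jacobian F (at (g \<theta>'))) *v grad loss (F (g \<theta>')))" for \<theta>'
    unfolding f_def by (simp add: grad_eqI[OF loss_F])
  then have f_diff: "f differentiable (at \<theta>')" for \<theta>'
    unfolding gderiv_def differentiable_def by blast
  have f_eq: "f (\<theta> t) = loss (yt t)" for t
    by (simp add: f_def trajectory)

  \<comment> \<open>Constants and radii\<close>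
  have inf_loss: "Inf (range loss) = 0"
  proof (rule cInf_eq_minimum)
    show "0 \<in> range loss" using loss_min(1) by (metis rangeI)
  qed (use loss_min(2) in auto)
  interpret desingularizer \<psi> \<Psi> r0
    using KL(3) \<Psi> by unfold_locales (auto simp: KL_def)
  have L0_bounds: "0 \<le> L0" "L0 < r0"
    using L0 loss_min(2) KL(1,2) by auto
  have KL_ineq: "1 \<le> deriv \<psi> (loss v) * norm (grad loss v)" if "0 < loss v" "loss v < r0" for v
    using KL(3) that by (simp add: KL_def inf_loss)

  have "0 \<le> R'"
    unfolding R' using nonneg[OF L0_bounds] \<sigma>(2) \<sigma>F(2) by simp
  then have "0 < R"
    using radii by (metis ereal_less_eq(3) order_le_less_trans zero_ereal_def)
  \<comment> \<open>The slope constant: half of \<sigma> survives on the ball, and \<sigma>F comes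
    from the forward operator.\<close>
  define k where "k = \<sigma> * \<sigma>F / 2"
  have "0 < k" using \<sigma>(2) \<sigma>F(2) by (simp add: k_def)
  have R'_eq: "R' = \<psi> L0 / k" by (simp add: R' k_def field_simps)
  have k2: "k\<^sup>2 = \<sigma>F\<^sup>2 * \<sigma>\<^sup>2 / 4" by (simp add: k_def power_mult_distrib power_divide)
  \<comment> \<open>A finite radius with room on both sides, even if \<open>R\<close> is
    infinite.\<close>
  obtain \<rho> where \<rho>: "R' < \<rho>" "ereal \<rho> < R"
    using ereal_dense2[OF radii] by auto

  \<comment> \<open>Slope of the composite loss near the initialization\<close>
  have Jg: "\<sigma> / 2 * norm z \<le> norm (transpose (jacobian g (at \<theta>')) *v z)"
    if "dist \<theta>0 \<theta>' \<le> \<rho>" for \<theta>' z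
  proof -
    have "ereal (dist \<theta>0 \<theta>') \<le> ereal \<rho>" using that by simp
    also have "\<dots> < R" by (rule \<rho>(2))
    finally have "\<theta>' \<in> ecball \<theta>0 R"
      by (simp add: ecball_def)
    from spectral_norm_diff_le_of_radius_eq[OF R \<sigma>(2) \<open>0 < R\<close> this]
    have "spectral_norm (jacobian g (at \<theta>') - jacobian g (at \<theta>0)) * norm z \<le> \<sigma> / 2 * norm z"
      by (rule mult_right_mono) simp
    moreover have "\<sigma> * norm z \<le> norm (transpose (jacobian g (at \<theta>0)) *v z)"
      unfolding \<sigma>(1)
      by (rule sigma_min_mult_norm_le, rule transpose_jacobian_network_eq_0[OF g activation(1) depth
            widths(3) bij_betw_imp_inj_on[OF layout]])
    ultimately show ?thesis
      using norm_transpose_mult_ge[of "jacobian g (at \<theta>0)" z "jacobian g (at \<theta>')"] by simp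
  qed
  have f_slope: "k \<le> deriv \<psi> (f (\<theta> t)) * norm (grad f (\<theta> t))"
    if t: "0 \<le> t" "dist \<theta>0 (\<theta> t) \<le> \<rho>" and ft: "0 < f (\<theta> t)" "f (\<theta> t) < r0" for t
  proof -
    define v where "v = grad loss (F (g (\<theta> t)))"
    have KL_v: "1 \<le> deriv \<psi> (f (\<theta> t)) * norm v"
      unfolding v_def f_def using KL_ineq ft unfolding f_def by blast
    \<comment> \<open>The KL inequality itself excludes a negative derivative, so multiplying by it
      preserves the gradient estimate.\<close>
    then have pos: "0 \<le> deriv \<psi> (f (\<theta> t))"
      by (smt (verit) mult_nonpos_nonneg norm_ge_zero)
    have "k * norm v = \<sigma> / 2 * (\<sigma>F * norm v)" by (simp add: k_def)
    also have "\<dots> \<le> \<sigma> / 2 * norm (transpose (jacobian F (at (g (\<theta> t)))) *v v)"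
      unfolding \<sigma>F(1) v_def using \<sigma>(2) \<Theta>_large[OF t(1)]
      by (intro mult_left_mono sigma_F_mult_norm_le range) auto
    also have "\<dots> \<le> norm (grad f (\<theta> t))"
      unfolding grad_eqI[OF f_grad] v_def by (rule Jg[OF t(2)])
    finally have "deriv \<psi> (f (\<theta> t)) * (k * norm v) \<le> deriv \<psi> (f (\<theta> t)) * norm (grad f (\<theta> t))"
      using pos by (rule mult_left_mono)
    moreover have "k * 1 \<le> k * (deriv \<psi> (f (\<theta> t)) * norm v)"
      using KL_v \<open>0 < k\<close> by (intro mult_left_mono) auto
    ultimately show ?thesis by (simp add: ac_simps)
  qed
  note init = flow(1)
  have f_0: "f (\<theta> 0) = L0" by (simp add: f_eq L0)
  interpret KL_gradient_flow \<psi> \<Psi> r0 f \<theta> k \<rho>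
  proof
    show "0 \<le> f z" for z by (simp add: f_def loss_min)
    show "f (\<theta> 0) < r0" using f_0 L0_bounds by simp
    show "(\<theta> has_vector_derivative - grad f (\<theta> t)) (at t within {0..})" if "0 \<le> t" for t
      using flow(2)[OF that] by (simp add: f_def)
    show "\<psi> (f (\<theta> 0)) / k < \<rho>" using \<rho>(1) R'_eq f_0 by simp
  qed (use f_diff \<open>0 < k\<close> f_slope flow(1) in auto)

  \<comment> \<open>Rates for the loss and the parameters\<close>
  have \<gamma>_eq: "\<gamma> t = ereal (k\<^sup>2 * t) + ext_prim \<Psi> (f (\<theta> 0))" for t
    by (simp add: \<gamma> k2 f_0)
  define P where "P t = prim_inv r0 \<Psi> (\<gamma> t)" for t
  have loss_le: "loss (yt t) \<le> P t" if "0 \<le> t" for t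
    using loss_le_prim_inv[OF that] by (simp add: P_def \<gamma>_eq f_eq)
  have P_bounds: "0 \<le> P t" "P t < r0" if "0 \<le> t" for t
    using prim_inv_bounds[OF f_nonneg loss_less[of 0], of "k\<^sup>2 * t"] that by (auto simp: P_def \<gamma>_eq)
  have psi_le: "\<psi> (loss (yt t)) \<le> \<psi> (P t)" if "0 \<le> t" for t
    using that by (intro mono loss_min loss_le P_bounds)
  obtain \<theta>_lim where lim: "(\<theta> \<longlongrightarrow> \<theta>_lim) at_top" "f \<theta>_lim = 0"
    "\<And>t. 0 \<le> t \<Longrightarrow> norm (\<theta> t - \<theta>_lim) \<le> \<psi> (f (\<theta> t)) / k"
    using flow_converges by blast

  have part1: "((\<lambda>t. loss (yt t)) \<longlongrightarrow> 0) at_top \<and> (\<forall>t\<ge>0. loss (yt t) \<le> P t) \<and>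
      (\<exists>\<theta>inf. (\<theta> \<longlongrightarrow> \<theta>inf) at_top \<and> \<theta>inf \<in> Argmin (\<lambda>\<theta>'. loss (F (g \<theta>'))) \<and>
         (\<forall>t\<ge>0. norm (\<theta> t - \<theta>inf) \<le> 2 / (\<sigma> * \<sigma>F) * \<psi> (P t)))"
  proof (intro conjI exI[of _ \<theta>_lim] allI impI)
    show "loss (yt t) \<le> P t" if "0 \<le> t" for t
      by (rule loss_le[OF that])
    show "((\<lambda>t. loss (yt t)) \<longlongrightarrow> 0) at_top"
      using loss_tendsto_0 by (simp add: f_eq)
    show "\<theta>_lim \<in> Argmin (\<lambda>\<theta>'. loss (F (g \<theta>')))"
      using lim(2) loss_min(2) by (auto simp: Argmin_def is_arg_min_def f_def not_less)
    fix t :: real assume "0 \<le> t"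
    have "\<psi> (loss (yt t)) / k \<le> \<psi> (P t) / k"
      using psi_le[OF \<open>0 \<le> t\<close>] \<open>0 < k\<close> by (simp add: divide_right_mono)
    then show "norm (\<theta> t - \<theta>_lim) \<le> 2 / (\<sigma> * \<sigma>F) * \<psi> (P t)"
      using lim(3)[OF \<open>0 \<le> t\<close>] by (simp add: f_eq k_def mult.commute)
  qed (rule lim(1))

  \<comment> \<open>Recovery of the observation\<close>
  have unique: "v = y" if "Argmin loss = {y}" "loss v = 0" for v
  proof -
    have "v \<in> Argmin loss"
      using that(2) loss_min(2) by (simp add: Argmin_def is_arg_min_def not_less)
    then show ?thesis using that(1) by simp
  qed
  have yt_lim: "(yt \<longlongrightarrow> y) at_top" if "Argmin loss = {y}"
  proof -
    have "isCont (\<lambda>\<theta>'. F (g \<theta>')) \<theta>_lim"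
      using differentiable_imp_continuous_within[OF g_diff]
      by (rule isCont_o2) (rule differentiable_imp_continuous_within[OF F_diff])
    then have "((\<lambda>t. F (g (\<theta> t))) \<longlongrightarrow> F (g \<theta>_lim)) at_top"
      using lim(1) by (rule isCont_tendsto_compose)
    moreover have "F (g \<theta>_lim) = y"
      using lim(2) by (intro unique that) (simp add: f_def)
    moreover have "yt = (\<lambda>t. F (g (\<theta> t)))"
      by (simp add: trajectory fun_eq_iff)
    ultimately show ?thesis by simp
  qed
  have err: "norm (yt t - y) \<le> \<psi> (loss (yt t))" if "Argmin loss = {y}" "0 \<le> t" for t
    using loss_less[OF that(2)]
    by (intro KL_error_bound loss_diff loss_min KL_ineq unique[OF that(1)]) (simp_all add: f_eq)

  have part2: "norm (yt t - F xbar) \<le> 2 * norm \<epsilon>"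
    if argmin: "Argmin loss = {y}" and t: "0 \<le> t"
      and late: "ereal (4 / (\<sigma>F\<^sup>2 * \<sigma>\<^sup>2)) *
        (ext_prim \<Psi> (inv_into {0..<r0} \<psi> (norm \<epsilon>)) - ext_prim \<Psi> L0) \<le> ereal t" for t
  proof -
    have "\<psi> (loss (yt t)) \<le> norm \<epsilon>"
    proof (cases "norm \<epsilon> \<in> \<psi> ` {0..<r0}")
      case True
      define s where "s = inv_into {0..<r0} \<psi> (norm \<epsilon>)"
      have s: "0 \<le> s" "s < r0" "\<psi> s = norm \<epsilon>"
        using inv_into_into[OF True] f_inv_into_f[OF True] by (auto simp: s_def)
      have late': "ereal (1 / k\<^sup>2) * (ext_prim \<Psi> s - ext_prim \<Psi> L0) \<le> ereal t"
        using late by (simp add: s_def k2)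
      have "loss (yt t) \<le> s"
      \<comment> \<open>If \<open>L0 = 0\<close>, the difference in \<open>late'\<close> may
        subtract infinity, but the loss is already 0. Otherwise \<open>ext_prim \<Psi> L0\<close> is
        finite and can be moved across.\<close>
      proof (cases "L0 = 0")
        case True
        then show ?thesis
          using loss_antimono[OF order_refl t] f_0 s(1) by (simp add: f_eq)
      next
        case False
        then have L0': "ext_prim \<Psi> L0 = ereal (\<Psi> L0)" by (simp add: ext_prim_def)
        have "ext_prim \<Psi> s \<le> ereal (k\<^sup>2 * t) + ext_prim \<Psi> L0"
          using late' \<open>0 < k\<close> unfolding L0' by (cases "ext_prim \<Psi> s") (auto simp: field_simps)
        then show ?thesis
          using loss_le_of_ext_prim_le[OF t s(1,2)] by (simp add: f_eq f_0[unfolded f_eq])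
      qed
      then show ?thesis
        using mono[of "loss (yt t)" s] s loss_min(2) by simp
    next
      \<comment> \<open>Here \<open>inv_into\<close> is arbitrary and \<open>late\<close> says
        nothing. But by continuity a number \<open>norm \<epsilon>\<close> that \<psi> misses lies
        above all its values.\<close>
      case False
      show ?thesis
      proof (rule ccontr)
        assume "\<not> \<psi> (loss (yt t)) \<le> norm \<epsilon>"
        moreover have "continuous_on {0..loss (yt t)} \<psi>"
          using loss_less[OF t] by (intro continuous_on_subset[OF continuous]) (auto simp: f_eq)
        ultimately obtain s where "0 \<le> s" "s \<le> loss (yt t)" "\<psi> s = norm \<epsilon>"
          using IVT'[of \<psi> 0 "norm \<epsilon>" "loss (yt t)"] zero loss_min(2) by auto
        with False loss_less[OF t] show False by (force simp: f_eq)
      qed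
    qed
    then have "norm (yt t - y) \<le> norm \<epsilon>"
      using err[OF argmin t] by simp
    then show ?thesis
      using norm_triangle_ineq[of "yt t - y" \<epsilon>] by (simp add: observation algebra_simps)
  qed

  \<comment> \<open>Recovery of the signal\<close>
  have xt_\<Sigma>': "xt t \<in> \<Sigma>'" if "0 \<le> t" for t
  proof -
    have "norm (\<theta> t) \<le> dist (\<theta> 0) (\<theta> t) + norm \<theta>0"
      using norm_triangle_sub[of "\<theta> t" "\<theta> 0"] by (simp add: dist_norm norm_minus_commute init)
    also have "\<dots> \<le> R' + norm \<theta>0"
      using dist_init_le[OF that] by (simp add: R'_eq f_0)
    finally show ?thesis by (simp add: trajectory \<Sigma>')
  qed
  have "0 \<in> \<Sigma>'"
    unfolding \<Sigma>' using \<open>0 \<le> R'\<close> by (intro image_eqI[of _ _ 0]) (simp_all add: g network_0)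
  have part3: "norm (xt t - xbar) \<le> \<psi> (P t) / mu_F F \<Sigma>' xp
      + (1 + L_F F xbar / mu_F F \<Sigma>' xp) * infdist xbar \<Sigma>' + norm \<epsilon> / mu_F F \<Sigma>' xp"
    if argmin: "Argmin loss = {y}" and xp: "is_arg_min (\<lambda>z. norm (z - xbar)) (\<lambda>z. z \<in> \<Sigma>') xp"
      and \<mu>: "0 < mu_F F \<Sigma>' xp" and t: "0 \<le> t" for xp t
  proof -
    define \<mu> where "\<mu> = mu_F F \<Sigma>' xp"
    have xp_min: "xp \<in> \<Sigma>'" "\<And>z. z \<in> \<Sigma>' \<Longrightarrow> norm (xp - xbar) \<le> norm (z - xbar)"
      using xp by (auto simp: is_arg_min_def not_less)
    have infdist: "infdist xbar \<Sigma>' = norm (xp - xbar)"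
    proof (rule antisym)
      show "infdist xbar \<Sigma>' \<le> norm (xp - xbar)"
        using infdist_le[OF xp_min(1), of xbar] by (simp add: dist_norm norm_minus_commute)
      show "norm (xp - xbar) \<le> infdist xbar \<Sigma>'"
        unfolding infdist_def using xp_min
        by (auto intro!: cINF_greatest simp: dist_norm norm_minus_commute)
    qed
    \<comment> \<open>Comparing the projection with the origin, a point of \<Sigma>', places it in
      the ball over which \<open>L_F\<close> is taken.\<close>
    have "norm xp \<le> 2 * norm xbar"
      using xp_min(2)[OF \<open>0 \<in> \<Sigma>'\<close>] norm_triangle_sub[of xp xbar] by simp
    then have lip: "norm (F xbar - F xp) \<le> L_F F xbar * norm (xp - xbar)"
      using norm_diff_le_L_F[OF forward(1), of xbar xbar xp] by (simp add: norm_minus_commute)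
    \<comment> \<open>Optimization error, noise and approximation error of the network.\<close>
    have "yt t - F xp = (yt t - y) + \<epsilon> + (F xbar - F xp)"
      by (simp add: observation)
    then have "norm (yt t - F xp) \<le> norm (yt t - y + \<epsilon>) + norm (F xbar - F xp)"
      by (metis norm_triangle_ineq)
    also have "\<dots> \<le> norm (yt t - y) + norm \<epsilon> + norm (F xbar - F xp)"
      by (intro add_right_mono norm_triangle_ineq)
    finally have "norm (yt t - F xp) \<le> \<dots>" .
    then have "\<mu> * norm (xt t - xp) \<le> \<psi> (P t) + norm \<epsilon> + L_F F xbar * norm (xp - xbar)"
      using mu_F_mult_norm_le[OF xt_\<Sigma>'[OF t], of F xp] err[OF argmin t] psi_le[OF t] lip
      unfolding \<mu>_def trajectory(2) by linarith
    then have "norm (xt t - xp) \<le> (\<psi> (P t) + norm \<epsilon> + L_F F xbar * norm (xp - xbar)) / \<mu>"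
      using \<mu> by (simp add: \<mu>_def field_simps)
    moreover have "norm (xt t - xbar) \<le> norm (xt t - xp) + norm (xp - xbar)"
      using norm_triangle_ineq[of "xt t - xp" "xp - xbar"] by simp
    moreover have "(\<psi> (P t) + norm \<epsilon> + L_F F xbar * norm (xp - xbar)) / \<mu> + norm (xp - xbar) =
        \<psi> (P t) / \<mu> + (1 + L_F F xbar / \<mu>) * norm (xp - xbar) + norm \<epsilon> / \<mu>"
      by (simp add: add_divide_distrib distrib_right)
    ultimately show ?thesis
      unfolding infdist \<mu>_def by linarith
  qed
  have weaken: "\<psi> (P t) / m \<le> 2 * \<psi> (P t) / (m * \<sigma> * \<sigma>F)"
    if "\<sigma> * \<sigma>F \<le> 2" "0 < m" "0 \<le> t" for t m
  proof -
    have "\<psi> (P t) / m = \<psi> (P t) / m * (\<sigma> * \<sigma>F) / (\<sigma> * \<sigma>F)"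
      using \<sigma>(2) \<sigma>F(2) by simp
    also have "\<dots> \<le> \<psi> (P t) / m * 2 / (\<sigma> * \<sigma>F)"
      using that \<sigma>(2) \<sigma>F(2) nonneg[OF P_bounds[OF that(3)]]
      by (intro divide_right_mono mult_left_mono) auto
    finally show ?thesis by (simp add: ac_simps)
  qed
  show ?thesis
    unfolding P_def[symmetric]
  proof (rule conjI[OF part1], intro conjI allI impI)
    show "(yt \<longlongrightarrow> y) at_top" if "Argmin loss = {y}"
      by (rule yt_lim[OF that])
    show "norm (yt t - F xbar) \<le> 2 * norm \<epsilon>"
      if "Argmin loss = {y}" "0 \<le> t" "ereal (4 / (\<sigma>F\<^sup>2 * \<sigma>\<^sup>2)) *
        (ext_prim \<Psi> (inv_into {0..<r0} \<psi> (norm \<epsilon>)) - ext_prim \<Psi> L0) \<le> ereal t" for t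
      by (rule part2[OF that])
    fix xp t
    assume "Argmin loss = {y} \<and> convex_on UNIV loss \<and>
        is_arg_min (\<lambda>z. norm (z - xbar)) (\<lambda>z. z \<in> \<Sigma>') xp \<and> 0 < mu_F F \<Sigma>' xp"
      and t: "0 \<le> (t::real)"
    then have xp: "Argmin loss = {y}" "is_arg_min (\<lambda>z. norm (z - xbar)) (\<lambda>z. z \<in> \<Sigma>') xp"
      "0 < mu_F F \<Sigma>' xp" by blast+
    show "norm (xt t - xbar) \<le> \<psi> (P t) / mu_F F \<Sigma>' xp
        + (1 + L_F F xbar / mu_F F \<Sigma>' xp) * infdist xbar \<Sigma>' + norm \<epsilon> / mu_F F \<Sigma>' xp"
      by (rule part3[OF xp t])
    then show "norm (xt t - xbar) \<le> 2 * \<psi> (P t) / (mu_F F \<Sigma>' xp * \<sigma> * \<sigma>F)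
        + (1 + L_F F xbar / mu_F F \<Sigma>' xp) * infdist xbar \<Sigma>' + norm \<epsilon> / mu_F F \<Sigma>' xp"
      if "\<sigma> * \<sigma>F \<le> 2"
      using weaken[OF that xp(3) t] by linarith
  qed
qed

end
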